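(* Let $Q:S\times S\to(0,\infty)$ be a symmetric transfer operator (the same on all edges), $S=\{1,\dots,q\}$, on the Cayley tree $(V,E)$ of order $d$, and let $l\in\Delta^{q-1}$ be a boundary law with $f(l)=l$ that is $f$-stable, i.e. the spectral radius of the differential $Df(l)$ (as a linear map on the tangent space of the simplex) is strictly smaller than one. Let $\mu^l_t$ be the time-evolved measure obtained from the tree-indexed Markov chain $\mu^l$ under the site-wise independent symmetric spin-flip dynamics. Then there exists $t_R<\infty$ such that $\mu^l_t$ is quasilocally Gibbs for all $t\ge t_R$.
   Context: Tree and configurations. $(V,E)$ is the Cayley tree of order $d$: the infinite tree in which every vertex has exactly $d+1$ nearest neighbors. $S=\{1,\dots,q\}$ with $q\ge 2$, $\Omega=S^V$ with product $\sigma$-algebra; $\sigma_\Lambda$ is the projection to $\Omega_\Lambda=S^\Lambda$; $\Lambda\Subset V$ means finite subset; $\partial\Lambda$ is the set of vertices in $\Lambda^c$ having a nearest neighbor in $\Lambda$. A function $\varphi:\Omega\to\mathbb R$ is local if it depends only on the spins in some finite set. For disjoint $\Lambda,\Delta$, $\omega_\Lambda\eta_\Delta$ denotes concatenation. Boundary laws. $\Delta^{q-1}$ is the simplex of probability vectors in $\mathbb R^q$. The map $f:\Delta^{q-1}\to\Delta^{q-1}$ is $f(l)=\frac{(Ql)^{\odot d}}{\|(Ql)^{\odot d}\|_1}$, where $v^{\odot d}=(v_1^d,\dots,v_q^d)$. A (normalized, spatially homogeneous) boundary law is a vector $l\in\Delta^{q-1}$ with positive entries and $f(l)=l$. $Df(l)$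 is regarded as a linear operator on the tangent space $T\Delta^{q-1}=\{x\in\mathbb R^q:\sum_i x_i=0\}$. The tree-indexed Markov chain $\mu^l$ is the probability measure on $\Omega$ such that for all finite connected $\Lambda$ and all $\omega\in\Omega$, $$\mu^l(\sigma_{\Lambda\cup\partial\Lambda}=\omega_{\Lambda\cup\partial\Lambda})=\frac1{Z_\Lambda}\prod_{\{x,y\}\in E,\ \{x,y\}\cap\Lambda\ne\emptyset}Q(\omega_x,\omega_y)\prod_{z\in\partial\Lambda}l(\omega_z),$$ with normalizing constant $Z_\Lambda$. Dynamics. $P_t(i,j)=\frac1q+\left(\delta_{ij}-\frac1q\right)e^{-\frac{q}{q-1}t}$ for $i,j\in S$, $t\ge0$. The time-evolved measure is $\mu^l_t=\mu^l\pi_t$ with $\pi_t(\sigma,d\eta)=\bigotimes_{x\in V}P_t(\sigma_x,d\eta_x)$, i.e. for local $\varphi$ with support $\Lambda\Subset V$, $\mu^l_t(\varphi)=\int_\Omega\sum_{\eta_\Lambda\in\Omega_\Lambda}\varphi(\eta_\Lambda)\prod_{x\in\Lambda}P_t(\omega_x,\eta_x)\,\mu^l(d\omega)$. Quasilocality. A configuration $\eta\in\Omega$ is good for $\mu^l_t$ if for all $x\in V$, all local functions $\varphi$ and each sequence of finite volumes $\Lambda_n\uparrow V$, $$\lim_{n\to\infty}\ \sup_{\xi^1,\xi^2\in\Omega,\ \Delta:\Lambda_n\subset\Delta\Subset V}\Big|\mu^l_t(\varphi\mid\eta_{\Lambda_n\setminus\{x\}}\xi^1_{\Delta\setminus\Lambda_n})-\mu^l_t(\varphi\mid\eta_{\Lambda_n\setminus\{x\}}\xi^2_{\Delta\setminus\Lambda_n})\Big|=0,$$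 where $\mu^l_t(\varphi\mid\eta_{\Lambda_n\setminus\{x\}}\xi_{\Delta\setminus\Lambda_n})$ is the conditional expectation of $\varphi$ given that the spins on $(\Lambda_n\setminus\{x\})\cup(\Delta\setminus\Lambda_n)$ equal the indicated configuration. $\mu^l_t$ is quasilocally Gibbs if all configurations are good. *)

theory Defs
  imports "HOL-Probability.Probability"
begin

section \<open>Cayley trees\<close>

text \<open>The vertex set is the universe of the type \<open>'v\<close>; \<open>E\<close> is a set of unordered pairs.\<close>

definition adjacent :: "'v set set \<Rightarrow> 'v \<Rightarrow> 'v \<Rightarrow> bool" where
  "adjacent E x y \<longleftrightarrow> {x, y} \<in> E"

definition simple_graph :: "'v set set \<Rightarrow> bool" where
  "simple_graph E \<longleftrightarrow> (\<forall>e\<in>E. card e = 2)"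

definition connected_in :: "'v set set \<Rightarrow> 'v set \<Rightarrow> bool" where
  "connected_in E \<Lambda> \<longleftrightarrow>
     (\<forall>x\<in>\<Lambda>. \<forall>y\<in>\<Lambda>. \<exists>p. p \<noteq> [] \<and> set p \<subseteq> \<Lambda> \<and> hd p = x \<and> last p = y \<and> successively (adjacent E) p)"

definition is_cycle :: "'v set set \<Rightarrow> 'v list \<Rightarrow> bool" where
  "is_cycle E p \<longleftrightarrow>
     length p \<ge> 3 \<and> distinct p \<and> successively (adjacent E) p \<and> adjacent E (last p) (hd p)"

definition is_tree :: "'v set set \<Rightarrow> bool" where
  "is_tree E \<longleftrightarrow> simple_graph E \<and> connected_in E UNIV \<and> (\<nexists>p. is_cycle E p)"

definition cayley_tree :: "nat \<Rightarrow> 'v set set \<Rightarrow> bool" where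
  "cayley_tree d E \<longleftrightarrow>
     infinite (UNIV :: 'v set) \<and> is_tree E \<and> (\<forall>x. card {y. adjacent E x y} = d + 1)"

definition outer_boundary :: "'v set set \<Rightarrow> 'v set \<Rightarrow> 'v set" where
  "outer_boundary E \<Lambda> = {y. y \<notin> \<Lambda> \<and> (\<exists>x\<in>\<Lambda>. adjacent E x y)}"


section \<open>Boundary laws and their stability\<close>

text \<open>The spin space \<open>{1,\<dots>,q}\<close> is the universe of a finite type \<open>'s\<close>, so \<open>q = CARD('s)\<close>.\<close>

definition prob_simplex :: "(real^'s) set" where
  "prob_simplex = {l. (\<forall>i. 0 \<le> l $ i) \<and> (\<Sum>i\<in>UNIV. l $ i) = 1}"

definition simplex_tangent :: "(real^'s) set" where
  "simplex_tangent = {x. (\<Sum>i\<in>UNIV. x $ i) = 0}"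

definition hadamard_power :: "real^'s \<Rightarrow> nat \<Rightarrow> real^'s" where
  "hadamard_power v d = (\<chi> i. (v $ i) ^ d)"

definition boundary_map :: "nat \<Rightarrow> real^'s^'s \<Rightarrow> real^'s \<Rightarrow> real^'s" where
  "boundary_map d Q l =
     (1 / (\<Sum>i\<in>UNIV. \<bar>hadamard_power (Q *v l) d $ i\<bar>)) *\<^sub>R hadamard_power (Q *v l) d"

definition boundary_law :: "nat \<Rightarrow> real^'s^'s \<Rightarrow> real^'s \<Rightarrow> bool" where
  "boundary_law d Q l \<longleftrightarrow> l \<in> prob_simplex \<and> (\<forall>i. 0 < l $ i) \<and> boundary_map d Q l = l"

text \<open>
  Complex eigenvalues of the restriction of a real linear map \<open>A\<close> to an invariant subspace \<open>T\<close>: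
  the pair \<open>(u, v)\<close> stands for the vector \<open>u + \<i> v\<close> of the complexification of \<open>T\<close>.
\<close>

definition complex_eigenvalues_on :: "'a::real_vector set \<Rightarrow> ('a \<Rightarrow> 'a) \<Rightarrow> complex set" where
  "complex_eigenvalues_on T A =
     {z. \<exists>u\<in>T. \<exists>v\<in>T. (u \<noteq> 0 \<or> v \<noteq> 0) \<and>
           A u = Re z *\<^sub>R u - Im z *\<^sub>R v \<and> A v = Im z *\<^sub>R u + Re z *\<^sub>R v}"

definition spectral_radius_on :: "'a::real_vector set \<Rightarrow> ('a \<Rightarrow> 'a) \<Rightarrow> real" where
  "spectral_radius_on T A = Sup (cmod ` complex_eigenvalues_on T A)"

text \<open>
  The formula for \<open>boundary_map\<close> makes sense in a neighbourhood of a positive \<open>l\<close>; the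
  differential on the tangent space of the simplex is the restriction of the full derivative,
  see \<open>boundary_map_differentiable\<close> and \<open>boundary_map_derivative_tangent\<close> below.
\<close>

definition boundary_law_stable :: "nat \<Rightarrow> real^'s^'s \<Rightarrow> real^'s \<Rightarrow> bool" where
  "boundary_law_stable d Q l \<longleftrightarrow>
     spectral_radius_on simplex_tangent (frechet_derivative (boundary_map d Q) (at l)) < 1"


section \<open>Tree-indexed Markov chains\<close>

definition config_space :: "('v \<Rightarrow> 's) measure" where
  "config_space = Pi\<^sub>M UNIV (\<lambda>_. count_space UNIV)"

definition cylinder :: "'v set \<Rightarrow> ('v \<Rightarrow> 's) \<Rightarrow> ('v \<Rightarrow> 's) set" where
  "cylinder \<Lambda> \<omega> = {\<sigma>. \<forall>x\<in>\<Lambda>. \<sigma> x = \<omega> x}"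

text \<open>For symmetric \<open>Q\<close> the value does not depend on the order of the end points.\<close>

definition edge_weight :: "real^'s^'s \<Rightarrow> ('v \<Rightarrow> 's) \<Rightarrow> 'v set \<Rightarrow> real" where
  "edge_weight Q \<omega> e = (THE r. \<exists>x y. e = {x, y} \<and> r = Q $ \<omega> x $ \<omega> y)"

definition volume_weight ::
  "'v set set \<Rightarrow> real^'s^'s \<Rightarrow> real^'s \<Rightarrow> 'v set \<Rightarrow> ('v \<Rightarrow> 's) \<Rightarrow> real" where
  "volume_weight E Q l \<Lambda> \<omega> =
     (\<Prod>e\<in>{e \<in> E. e \<inter> \<Lambda> \<noteq> {}}. edge_weight Q \<omega> e) * (\<Prod>z\<in>outer_boundary E \<Lambda>. l $ \<omega> z)"

definition volume_partition ::
  "'v set set \<Rightarrow> real^'s^'s \<Rightarrow> real^'s \<Rightarrow> 'v set \<Rightarrow> real" where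
  "volume_partition E Q l \<Lambda> =
     (\<Sum>\<omega>\<in>(\<Lambda> \<union> outer_boundary E \<Lambda>) \<rightarrow>\<^sub>E UNIV. volume_weight E Q l \<Lambda> \<omega>)"

definition tree_markov_chain ::
  "'v set set \<Rightarrow> real^'s^'s \<Rightarrow> real^'s \<Rightarrow> ('v \<Rightarrow> 's) measure \<Rightarrow> bool" where
  "tree_markov_chain E Q l \<mu> \<longleftrightarrow>
     prob_space \<mu> \<and> sets \<mu> = sets config_space \<and>
     (\<forall>\<Lambda> \<omega>. finite \<Lambda> \<longrightarrow> \<Lambda> \<noteq> {} \<longrightarrow> connected_in E \<Lambda> \<longrightarrow>
        measure \<mu> (cylinder (\<Lambda> \<union> outer_boundary E \<Lambda>) \<omega>) =
        volume_weight E Q l \<Lambda> \<omega> / volume_partition E Q l \<Lambda>)"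


section \<open>Independent symmetric spin-flip dynamics\<close>

definition flip_prob :: "real \<Rightarrow> 's::finite \<Rightarrow> 's \<Rightarrow> real" where
  "flip_prob t i j =
     1 / real CARD('s) +
     ((if i = j then 1 else 0) - 1 / real CARD('s)) *
       exp (- (real CARD('s) / (real CARD('s) - 1)) * t)"

definition flip_kernel :: "real \<Rightarrow> ('v \<Rightarrow> 's::finite) \<Rightarrow> ('v \<Rightarrow> 's) measure" where
  "flip_kernel t \<sigma> = Pi\<^sub>M UNIV (\<lambda>x. point_measure UNIV (\<lambda>j. ennreal (flip_prob t (\<sigma> x) j)))"

definition time_evolved :: "('v \<Rightarrow> 's::finite) measure \<Rightarrow> real \<Rightarrow> ('v \<Rightarrow> 's) measure" where
  "time_evolved \<mu> t = \<mu> \<bind> flip_kernel t"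


section \<open>Quasilocality\<close>

definition local_function :: "(('v \<Rightarrow> 's) \<Rightarrow> real) \<Rightarrow> bool" where
  "local_function \<phi> \<longleftrightarrow>
     (\<exists>\<Lambda>. finite \<Lambda> \<and> (\<forall>\<omega> \<omega>'. (\<forall>x\<in>\<Lambda>. \<omega> x = \<omega>' x) \<longrightarrow> \<phi> \<omega> = \<phi> \<omega>'))"

text \<open>Conditional expectation given that the spins on \<open>\<Lambda>\<close> agree with \<open>\<zeta>\<close>
  (an event of positive probability in the situation of interest).\<close>

definition cond_expect_spins ::
  "('v \<Rightarrow> 's) measure \<Rightarrow> (('v \<Rightarrow> 's) \<Rightarrow> real) \<Rightarrow> 'v set \<Rightarrow> ('v \<Rightarrow> 's) \<Rightarrow> real" where
  "cond_expect_spins \<nu> \<phi> \<Lambda> \<zeta> =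
     set_lebesgue_integral \<nu> (cylinder \<Lambda> \<zeta>) \<phi> / measure \<nu> (cylinder \<Lambda> \<zeta>)"

definition exhausting :: "(nat \<Rightarrow> 'v set) \<Rightarrow> bool" where
  "exhausting \<Lambda> \<longleftrightarrow> (\<forall>n. finite (\<Lambda> n)) \<and> incseq \<Lambda> \<and> (\<Union>n. \<Lambda> n) = UNIV"

text \<open>The spins in \<open>\<Lambda> - {x}\<close> are taken from \<open>\<eta>\<close> and those in \<open>\<Delta> - \<Lambda>\<close> from \<open>\<xi>\<close>;
  the spin at \<open>x\<close> is not conditioned upon if \<open>x \<in> \<Lambda>\<close>.\<close>

definition cond_expect_concat ::
  "('v \<Rightarrow> 's) measure \<Rightarrow> (('v \<Rightarrow> 's) \<Rightarrow> real) \<Rightarrow> 'v \<Rightarrow> 'v set \<Rightarrow> ('v \<Rightarrow> 's) \<Rightarrow>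
   'v set \<Rightarrow> ('v \<Rightarrow> 's) \<Rightarrow> real" where
  "cond_expect_concat \<nu> \<phi> x \<Lambda> \<eta> \<Delta> \<xi> =
     cond_expect_spins \<nu> \<phi> ((\<Lambda> - {x}) \<union> (\<Delta> - \<Lambda>)) (\<lambda>y. if y \<in> \<Lambda> then \<eta> y else \<xi> y)"

definition good_config :: "('v \<Rightarrow> 's) measure \<Rightarrow> ('v \<Rightarrow> 's) \<Rightarrow> bool" where
  "good_config \<nu> \<eta> \<longleftrightarrow>
     (\<forall>x \<phi> \<Lambda>. local_function \<phi> \<longrightarrow> exhausting \<Lambda> \<longrightarrow>
        (\<lambda>n. SUP (\<xi>\<^sub>1, \<xi>\<^sub>2, \<Delta>) \<in> UNIV \<times> UNIV \<times> {\<Delta>. finite \<Delta> \<and> \<Lambda> n \<subseteq> \<Delta>}.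
               \<bar>cond_expect_concat \<nu> \<phi> x (\<Lambda> n) \<eta> \<Delta> \<xi>\<^sub>1 -
                cond_expect_concat \<nu> \<phi> x (\<Lambda> n) \<eta> \<Delta> \<xi>\<^sub>2\<bar>) \<longlonglongrightarrow> 0)"

definition quasilocally_gibbs :: "('v \<Rightarrow> 's) measure \<Rightarrow> bool" where
  "quasilocally_gibbs \<nu> \<longleftrightarrow> (\<forall>\<eta>. good_config \<nu> \<eta>)"


section \<open>Consistency of the definitions\<close>

lemma edge_weight_pair:
  assumes "transpose Q = Q"
  shows "edge_weight Q \<omega> {x, y} = Q $ \<omega> x $ \<omega> y"
proof -
  have sym: "Q $ i $ j = Q $ j $ i" for i j
    using assms by (metis transpose_def vec_lambda_beta)
  show ?thesis
    unfolding edge_weight_def by (rule the_equality) (auto simp: doubleton_eq_iff sym)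
qed

context
  fixes d :: nat and Q :: "real^'s^'s" and l :: "real^'s"
  assumes Q_pos: "\<And>i j. 0 < Q $ i $ j" and l_pos: "\<And>i. 0 < l $ i"
begin

lemma matrix_vector_pos: "0 < (Q *v l) $ i"
  unfolding matrix_vector_mult_def using Q_pos l_pos by (auto intro!: sum_pos)

lemma boundary_map_eq_near:
  "\<forall>\<^sub>F x in nhds l. boundary_map d Q x =
     (\<chi> i. ((Q *v x) $ i) ^ d / (\<Sum>j\<in>UNIV. ((Q *v x) $ j) ^ d)) \<and>
     0 < (\<Sum>j\<in>UNIV. ((Q *v x) $ j) ^ d)"
proof -
  have "\<forall>\<^sub>F x in nhds l. 0 < (Q *v x) $ i" for i
  proof -
    have "((\<lambda>x. (Q *v x) $ i) \<longlongrightarrow> (Q *v l) $ i) (nhds l)"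
      unfolding matrix_vector_mult_def by (auto intro!: tendsto_intros filterlim_ident)
    then show ?thesis using matrix_vector_pos by (rule order_tendstoD(1))
  qed
  then have "\<forall>\<^sub>F x in nhds l. \<forall>i. 0 < (Q *v x) $ i"
    by (rule eventually_all_finite)
  then show ?thesis
  proof eventually_elim
    case (elim x)
    then have "\<bar>((Q *v x) $ i) ^ d\<bar> = ((Q *v x) $ i) ^ d" for i
      by (simp add: less_imp_le)
    then show ?case
      using elim by (auto simp: boundary_map_def hadamard_power_def vec_eq_iff intro!: sum_pos)
  qed
qed

lemma boundary_map_differentiable: "boundary_map d Q differentiable (at l)"
proof -
  let ?g = "\<lambda>x. \<chi> i. ((Q *v x) $ i) ^ d / (\<Sum>j\<in>UNIV. ((Q *v x) $ j) ^ d)"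
  have ev: "\<forall>\<^sub>F x in nhds l. boundary_map d Q x = ?g x"
    using boundary_map_eq_near by eventually_elim auto
  have nz: "(\<Sum>j\<in>UNIV. ((Q *v l) $ j) ^ d) \<noteq> 0"
    using boundary_map_eq_near[THEN eventually_nhds_x_imp_x] by simp
  have lin: "(\<lambda>x. (Q *v x) $ i) differentiable (at l)" for i
    by (intro bounded_linear_imp_differentiable
        bounded_linear_compose[OF bounded_linear_vec_nth matrix_vector_mul_bounded_linear])
  have "(\<lambda>x. ?g x $ i) differentiable (at l)" for i
    using nz lin by (auto intro!: differentiable_divide differentiable_power differentiable_sum)
  then have "(\<lambda>x. ?g x \<bullet> b) differentiable (at l)" if "b \<in> Basis" for b
    using that by (auto simp: Basis_vec_def inner_axis)
  then have "?g differentiable (at l)"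
    using differentiable_componentwise_within[of ?g l UNIV] by simp
  then obtain D where "(?g has_derivative D) (at l)"
    unfolding differentiable_def by auto
  moreover have "\<forall>\<^sub>F x in at l. ?g x = boundary_map d Q x"
    using ev unfolding eventually_at_filter by eventually_elim auto
  moreover have "?g l = boundary_map d Q l"
    using ev by (auto dest: eventually_nhds_x_imp_x)
  ultimately have "(boundary_map d Q has_derivative D) (at l)"
    by (rule has_derivative_transform_eventually[OF _ _ _ UNIV_I])
  then show ?thesis unfolding differentiable_def by auto
qed

lemma boundary_map_derivative_tangent:
  "frechet_derivative (boundary_map d Q) (at l) x \<in> simplex_tangent"
proof -
  let ?D = "frechet_derivative (boundary_map d Q) (at l)"
  have "(boundary_map d Q has_derivative ?D) (at l)"
    using boundary_map_differentiable frechet_derivative_works by blast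
  then have 1: "((\<lambda>x. \<Sum>i\<in>UNIV. boundary_map d Q x $ i) has_derivative (\<lambda>x. \<Sum>i\<in>UNIV. ?D x $ i)) (at l)"
    by (intro has_derivative_sum bounded_linear.has_derivative[OF bounded_linear_vec_nth])
  have ev: "\<forall>\<^sub>F x in nhds l. 1 = (\<Sum>i\<in>UNIV. boundary_map d Q x $ i)"
    using boundary_map_eq_near
    by eventually_elim (auto simp: sum_divide_distrib[symmetric])
  then have "\<forall>\<^sub>F x in at l. 1 = (\<Sum>i\<in>UNIV. boundary_map d Q x $ i)"
    unfolding eventually_at_filter by eventually_elim auto
  moreover have "1 = (\<Sum>i\<in>UNIV. boundary_map d Q l $ i)"
    using ev by (rule eventually_nhds_x_imp_x)
  ultimately have "((\<lambda>x. \<Sum>i\<in>UNIV. boundary_map d Q x $ i) has_derivative (\<lambda>x. 0)) (at l)"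
    by (rule has_derivative_transform_eventually[OF has_derivative_const _ _ UNIV_I])
  with 1 have "(\<lambda>x. \<Sum>i\<in>UNIV. ?D x $ i) = (\<lambda>x. 0)"
    by (rule has_derivative_unique)
  then show ?thesis
    unfolding simplex_tangent_def by (simp add: fun_eq_iff)
qed

end

lemma flip_prob_nonneg:
  fixes i j :: "'s::finite"
  assumes "CARD('s) \<ge> 2" "0 \<le> t"
  shows "0 \<le> flip_prob t i j"
proof -
  let ?q = "real CARD('s)" and ?e = "exp (- (real CARD('s) / (real CARD('s) - 1)) * t)"
  have q: "?q \<ge> 2" using assms by simp
  have e: "0 < ?e" "?e \<le> 1" using q assms by auto
  have "0 \<le> 1 / ?q * (1 - ?e)" using e q by simp
  also have "\<dots> \<le> flip_prob t i j"
    unfolding flip_prob_def using e by (simp add: algebra_simps)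
  finally show ?thesis .
qed

lemma sum_flip_prob: "(\<Sum>j\<in>UNIV. flip_prob t i (j::'s::finite)) = 1"
proof -
  have "(\<Sum>j\<in>UNIV. (if i = j then 1 else 0) - 1 / real CARD('s)) = 0"
    by (simp add: sum_subtractf)
  then show ?thesis
    unfolding flip_prob_def by (simp add: sum.distrib sum_distrib_right[symmetric])
qed

lemma prob_space_flip:
  assumes "CARD('s::finite) \<ge> 2" "0 \<le> t"
  shows "prob_space (point_measure UNIV (\<lambda>j::'s. ennreal (flip_prob t i j)))"
  by (rule prob_spaceI)
     (simp add: space_point_measure emeasure_point_measure_finite sum_ennreal flip_prob_nonneg[OF assms] sum_flip_prob)

lemma space_config_space [simp]: "space config_space = UNIV"
  by (auto simp: config_space_def space_PiM)

lemma sets_flip_kernel [simp]: "sets (flip_kernel t \<sigma>) = sets config_space"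
  unfolding flip_kernel_def config_space_def by (intro sets_PiM_cong) auto

lemma sets_cylinder: "finite \<Lambda> \<Longrightarrow> cylinder \<Lambda> \<omega> \<in> sets config_space"
proof -
  assume "finite \<Lambda>"
  then have "prod_emb UNIV (\<lambda>_. count_space UNIV) \<Lambda> (\<Pi>\<^sub>E x\<in>\<Lambda>. {\<omega> x}) \<in> sets config_space"
    unfolding config_space_def by (intro sets_PiM_I) auto
  also have "prod_emb UNIV (\<lambda>_. count_space UNIV) \<Lambda> (\<Pi>\<^sub>E x\<in>\<Lambda>. {\<omega> x}) = cylinder \<Lambda> \<omega>"
    by (auto simp: prod_emb_def cylinder_def PiE_iff)
  finally show ?thesis .
qed

lemma prob_space_flip_kernel:
  fixes \<sigma> :: "'v \<Rightarrow> 's::finite"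
  assumes "CARD('s) \<ge> 2" "0 \<le> t"
  shows "prob_space (flip_kernel t \<sigma>)"
  unfolding flip_kernel_def using prob_space_flip[OF assms] by (intro prob_space_PiM) auto

lemma emeasure_flip_kernel:
  fixes \<sigma> :: "'v \<Rightarrow> 's::finite"
  assumes "CARD('s) \<ge> 2" "0 \<le> t" "finite J"
  shows "emeasure (flip_kernel t \<sigma>) (prod_emb UNIV (\<lambda>_. count_space UNIV) J (Pi\<^sub>E J X)) =
           (\<Prod>x\<in>J. ennreal (\<Sum>j\<in>X x. flip_prob t (\<sigma> x) j))"
proof -
  let ?M = "\<lambda>x. point_measure UNIV (\<lambda>j. ennreal (flip_prob t (\<sigma> x) j))"
  have "prod_emb UNIV (\<lambda>_. count_space UNIV) J (Pi\<^sub>E J X) = prod_emb UNIV ?M J (Pi\<^sub>E J X)"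
    by (simp add: prod_emb_def space_point_measure)
  also have "emeasure (flip_kernel t \<sigma>) \<dots> = (\<Prod>x\<in>J. emeasure (?M x) (X x))"
    unfolding flip_kernel_def using assms
    by (intro emeasure_PiM_emb prob_space_flip) auto
  finally show ?thesis
    using flip_prob_nonneg[OF assms(1,2)]
    by (simp add: emeasure_point_measure_finite sum_ennreal)
qed

lemma measurable_flip_kernel:
  assumes "CARD('s::finite) \<ge> 2" "0 \<le> t"
  shows "flip_kernel t \<in> measurable (config_space :: ('v \<Rightarrow> 's) measure) (prob_algebra config_space)"
proof (rule measurable_prob_algebra_generated)
  show "sets (config_space :: ('v \<Rightarrow> 's) measure) =
      sigma_sets (\<Pi>\<^sub>E i\<in>UNIV. space (count_space UNIV)) (prod_algebra UNIV (\<lambda>_. count_space UNIV))"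
    unfolding config_space_def sets_PiM ..
next
  fix A :: "('v \<Rightarrow> 's) set" assume "A \<in> prod_algebra UNIV (\<lambda>_. count_space UNIV)"
  then obtain J X where J: "finite J"
    and A: "A = prod_emb UNIV (\<lambda>_. count_space UNIV) J (Pi\<^sub>E J X)"
    by (auto elim!: prod_algebraE)
  have [measurable]: "(\<lambda>\<sigma>::'v \<Rightarrow> 's. \<sigma> x) \<in> measurable config_space (count_space UNIV)" for x
    unfolding config_space_def by (rule measurable_component_singleton) simp
  show "(\<lambda>\<sigma>. emeasure (flip_kernel t \<sigma>) A) \<in> borel_measurable config_space"
    unfolding A emeasure_flip_kernel[OF assms J] by measurable
qed (auto simp: Int_stable_prod_algebra prod_algebra_sets_into_space prob_space_flip_kernel assms)

lemma
  fixes \<mu> :: "('v \<Rightarrow> 's::finite) measure"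
  assumes "CARD('s) \<ge> 2" "0 \<le> t" "prob_space \<mu>" "sets \<mu> = sets config_space"
  shows prob_space_time_evolved: "prob_space (time_evolved \<mu> t)"
    and sets_time_evolved: "sets (time_evolved \<mu> t) = sets config_space"
proof -
  have \<mu>: "\<mu> \<in> space (prob_algebra config_space)"
    using assms by (simp add: space_prob_algebra)
  show "prob_space (time_evolved \<mu> t)"
    unfolding time_evolved_def by (rule prob_space_bind'[OF \<mu> measurable_flip_kernel[OF assms(1,2)]])
  show "sets (time_evolved \<mu> t) = sets config_space"
    unfolding time_evolved_def by (rule sets_bind'[OF \<mu> measurable_flip_kernel[OF assms(1,2)]])
qed

text \<open>The action of \<open>time_evolved\<close> on a function that depends only on the spins in \<open>\<Lambda>\<close>.\<close>

lemma integral_time_evolved_local: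
  fixes \<mu> :: "('v \<Rightarrow> 's::finite) measure" and \<phi> :: "('v \<Rightarrow> 's) \<Rightarrow> real"
  assumes q: "CARD('s) \<ge> 2" and t: "0 \<le> t"
    and \<mu>: "prob_space \<mu>" "sets \<mu> = sets config_space"
    and \<Lambda>: "finite \<Lambda>" and loc: "\<And>\<omega> \<omega>'. (\<forall>x\<in>\<Lambda>. \<omega> x = \<omega>' x) \<Longrightarrow> \<phi> \<omega> = \<phi> \<omega>'"
  shows "(\<integral>\<sigma>. \<phi> \<sigma> \<partial>time_evolved \<mu> t) =
    (\<integral>\<omega>. (\<Sum>\<eta>\<in>\<Lambda> \<rightarrow>\<^sub>E UNIV. \<phi> \<eta> * (\<Prod>x\<in>\<Lambda>. flip_prob t (\<omega> x) (\<eta> x))) \<partial>\<mu>)"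
proof -
  let ?\<nu> = "time_evolved \<mu> t"
  interpret \<mu>: prob_space \<mu> by fact
  interpret \<nu>: prob_space ?\<nu> using prob_space_time_evolved[OF q t \<mu>] .
  have fin: "finite (\<Lambda> \<rightarrow>\<^sub>E (UNIV::'s set))" using \<Lambda> by (intro finite_PiE) auto
  have [measurable]: "cylinder \<Lambda> \<eta> \<in> sets ?\<nu>" for \<eta>
    using sets_cylinder[OF \<Lambda>] sets_time_evolved[OF q t \<mu>] by simp
  have [measurable]: "(\<lambda>\<sigma>::'v \<Rightarrow> 's. \<sigma> x) \<in> measurable \<mu> (count_space UNIV)" for x
    unfolding measurable_cong_sets[OF \<mu>(2) refl] config_space_def
    by (rule measurable_component_singleton) simp
  have nonneg: "0 \<le> flip_prob t i j" for i j :: 's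
    by (rule flip_prob_nonneg[OF q t])
  have le1: "flip_prob t i j \<le> 1" for i j :: 's
    using member_le_sum[of j UNIV "flip_prob t i"] nonneg by (simp add: sum_flip_prob)
  have dec: "\<phi> \<sigma> = (\<Sum>\<eta>\<in>\<Lambda> \<rightarrow>\<^sub>E UNIV. \<phi> \<eta> * indicator (cylinder \<Lambda> \<eta>) \<sigma>)" for \<sigma>
  proof -
    have "(\<Sum>\<eta>\<in>\<Lambda> \<rightarrow>\<^sub>E UNIV. \<phi> \<eta> * indicator (cylinder \<Lambda> \<eta>) \<sigma>) =
        (\<Sum>\<eta>\<in>\<Lambda> \<rightarrow>\<^sub>E UNIV. if restrict \<sigma> \<Lambda> = \<eta> then \<phi> \<eta> else 0)"
      by (intro sum.cong refl) (auto simp: cylinder_def indicator_def PiE_iff extensional_def fun_eq_iff)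
    also have "\<dots> = \<phi> (restrict \<sigma> \<Lambda>)" using fin by simp
    also have "\<dots> = \<phi> \<sigma>" by (rule loc) simp
    finally show ?thesis by simp
  qed
  have int: "integrable \<mu> (\<lambda>\<omega>. \<Prod>x\<in>\<Lambda>. flip_prob t (\<omega> x) (\<eta> x))" for \<eta>
    using nonneg le1 by (intro \<mu>.integrable_const_bound[where B=1]) (auto intro!: prod_le_1 simp: abs_prod)
  have cyl: "measure ?\<nu> (cylinder \<Lambda> \<eta>) = (\<integral>\<omega>. (\<Prod>x\<in>\<Lambda>. flip_prob t (\<omega> x) (\<eta> x)) \<partial>\<mu>)" for \<eta>
  proof -
    have c: "cylinder \<Lambda> \<eta> = prod_emb UNIV (\<lambda>_. count_space UNIV) \<Lambda> (\<Pi>\<^sub>E x\<in>\<Lambda>. {\<eta> x})"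
      by (auto simp: prod_emb_def cylinder_def PiE_iff)
    have "emeasure ?\<nu> (cylinder \<Lambda> \<eta>) = (\<integral>\<^sup>+\<omega>. emeasure (flip_kernel t \<omega>) (cylinder \<Lambda> \<eta>) \<partial>\<mu>)"
      unfolding time_evolved_def using \<mu> measurable_flip_kernel[OF q t] sets_cylinder[OF \<Lambda>]
      by (intro emeasure_bind_prob_algebra) (auto simp: space_prob_algebra)
    also have "\<dots> = (\<integral>\<^sup>+\<omega>. ennreal (\<Prod>x\<in>\<Lambda>. flip_prob t (\<omega> x) (\<eta> x)) \<partial>\<mu>)"
      unfolding c emeasure_flip_kernel[OF q t \<Lambda>] using nonneg by (simp add: prod_ennreal)
    also have "\<dots> = ennreal (\<integral>\<omega>. (\<Prod>x\<in>\<Lambda>. flip_prob t (\<omega> x) (\<eta> x)) \<partial>\<mu>)"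
      using int nonneg by (intro nn_integral_eq_integral) (auto intro!: prod_nonneg)
    finally show ?thesis
      using nonneg by (simp add: measure_def integral_nonneg_AE prod_nonneg)
  qed
  have "(\<integral>\<sigma>. \<phi> \<sigma> \<partial>?\<nu>) = (\<integral>\<sigma>. (\<Sum>\<eta>\<in>\<Lambda> \<rightarrow>\<^sub>E UNIV. \<phi> \<eta> * indicator (cylinder \<Lambda> \<eta>) \<sigma>) \<partial>?\<nu>)"
    by (intro Bochner_Integration.integral_cong refl dec)
  also have "\<dots> = (\<Sum>\<eta>\<in>\<Lambda> \<rightarrow>\<^sub>E UNIV. \<phi> \<eta> * measure ?\<nu> (cylinder \<Lambda> \<eta>))"
    by (subst Bochner_Integration.integral_sum) (auto simp: \<nu>.emeasure_eq_measure)
  also have "\<dots> = (\<integral>\<omega>. (\<Sum>\<eta>\<in>\<Lambda> \<rightarrow>\<^sub>E UNIV. \<phi> \<eta> * (\<Prod>x\<in>\<Lambda>. flip_prob t (\<omega> x) (\<eta> x))) \<partial>\<mu>)"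
    unfolding cyl using int by (subst Bochner_Integration.integral_sum) auto
  finally show ?thesis .
qed

end

theory Submission
  imports Defs "HOL-Computational_Algebra.Fundamental_Theorem_Algebra"
begin

text \<open>
  Conditioning the time-evolved measure on spins in a finite set turns the initial chain into a tree
  model with a site-dependent field \<open>P\<^sub>t(\<cdot>, \<eta>\<^sub>y)\<close>. Its marginal at a site \<open>x\<close> is computed by
  passing messages along the tree rooted at \<open>x\<close>, starting from the boundary law \<open>l\<close> far away. For
  large \<open>t\<close> every field is nearly constant, so each update is a small perturbation of \<open>f\<close>
  with its \<open>d\<close> arguments decoupled. Stability of \<open>l\<close> provides a norm in which \<open>Df(l)\<close> is a
  contraction; the updates then preserve a small ball around \<open>l\<close> and contract it uniformly in
  the fields. Changing the conditioning at distance more than \<open>r\<close> from \<open>x\<close> thus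
  moves the messages arriving at \<open>x\<close> by at most a multiple of \<open>\<kappa>\<^sup>r\<close>, for every \<open>\<eta>\<close>.
\<close>

text \<open>Spectral radius below one says nothing about a prescribed norm, and it is known only on
  the tangent space; this forces the change of norm. The \<open>d\<close> arguments of an update
  enter symmetrically, so each partial derivative at \<open>l\<close> is the d-th part of
  \<open>Df(l)\<close>, and the linearised update contracts in the maximum over incoming messages as
  fast as \<open>Df(l)\<close> does. No basin of attraction has to be determined: the chain puts
  exactly \<open>l\<close> on the boundary of every ball, so the messages start at the centre of the
  region of contraction. Errors are measured by ratios, because messages are normalised products and
  fields matter only up to a scalar. A site that is not observed carries a constant field, so
  conditioning sets with holes fit the same scheme. Two conditionings that agree near the site of
  interest produce equal fields there, hence contraction is only used for two updates with a common
  field.\<close>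

section \<open>Linear maps of spectral radius less than one\<close>

text \<open>Multiplication by \<open>z\<close> in the complexification, where \<open>(u, v)\<close>
  stands for u + iv; the equations in \<open>complex_eigenvalues_on\<close> then read
  \<open>map_prod A A w = cmult z w\<close>. Complex scalars allow polynomials to be split into
  linear factors.\<close>

definition cmult :: "complex \<Rightarrow> 'a::real_vector \<times> 'a \<Rightarrow> 'a \<times> 'a" where
  "cmult z w = (Re z *\<^sub>R fst w - Im z *\<^sub>R snd w, Im z *\<^sub>R fst w + Re z *\<^sub>R snd w)"

lemma cmult_add_left: "cmult (a + b) w = cmult a w + cmult b w"
  by (simp add: cmult_def algebra_simps)

lemma cmult_add_right: "cmult a (v + w) = cmult a v + cmult a w"
  by (simp add: cmult_def algebra_simps)

lemma cmult_cmult: "cmult a (cmult b w) = cmult (a * b) w"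
  by (simp add: cmult_def algebra_simps)

lemma cmult_simps [simp]:
  "cmult 0 w = 0" "cmult 1 w = w" "cmult a 0 = 0" "cmult (- a) w = - cmult a w"
  by (simp_all add: cmult_def zero_prod_def)

text \<open>The cross terms cancel in the Euclidean norm of the product. Equality lets
  \<open>cmod z\<close> serve directly as a contraction rate.\<close>

lemma norm_cmult:
  fixes w :: "'a::real_inner \<times> 'a"
  shows "norm (cmult z w) = cmod z * norm w"
proof -
  have "(norm (cmult z w))\<^sup>2 = (cmod z * norm w)\<^sup>2"
    unfolding power_mult_distrib cmod_power2 unfolding power2_norm_eq_inner
    by (simp add: cmult_def inner_prod_def inner_diff_left inner_diff_right inner_add_left
        inner_add_right algebra_simps inner_commute power2_eq_square)
  then show ?thesis by (simp add: power2_eq_iff_nonneg)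
qed

text \<open>This is p(A) applied to \<open>w\<close> in the complexification, evaluated by Horner's
  scheme.\<close>

definition poly_act :: "('a::real_vector \<Rightarrow> 'a) \<Rightarrow> complex poly \<Rightarrow> 'a \<times> 'a \<Rightarrow> 'a \<times> 'a" where
  "poly_act A p w = fold_coeffs (\<lambda>a v. cmult a w + map_prod A A v) p 0"

context
  fixes A :: "'a::real_vector \<Rightarrow> 'a"
  assumes A: "linear A"
begin

lemma map_prod_add: "map_prod A A (v + w) = map_prod A A v + map_prod A A w"
  by (cases v; cases w) (simp add: linear_add[OF A])

lemma map_prod_cmult: "map_prod A A (cmult z w) = cmult z (map_prod A A w)"
  by (cases w) (simp add: cmult_def linear_add[OF A] linear_diff[OF A] linear_scale[OF A])

lemma map_prod_zero: "map_prod A A 0 = 0"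
  by (simp add: zero_prod_def linear_0[OF A])

lemma poly_act_0: "poly_act A 0 w = 0"
  by (simp add: poly_act_def)

lemma poly_act_pCons: "poly_act A (pCons a p) w = cmult a w + map_prod A A (poly_act A p w)"
  by (cases "a = 0 \<and> p = 0") (auto simp: poly_act_def map_prod_zero)

lemma poly_act_add: "poly_act A (p + q) w = poly_act A p w + poly_act A q w"
  by (induction p q rule: poly_induct2)
     (simp_all add: poly_act_0 poly_act_pCons map_prod_add cmult_add_left)

lemma poly_act_smult: "poly_act A (smult c p) w = cmult c (poly_act A p w)"
  by (induction p) (simp_all add: poly_act_0 poly_act_pCons map_prod_cmult cmult_add_right cmult_cmult)

lemma poly_act_linear_factor:
  "poly_act A ([:- z, 1:] * r) w = map_prod A A (poly_act A r w) - cmult z (poly_act A r w)"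
proof -
  have "[:- z, 1:] * r = smult (- z) r + pCons 0 r" by simp
  then show ?thesis
    by (simp only: poly_act_add poly_act_smult poly_act_pCons) simp
qed

text \<open>Polynomials in \<open>A\<close> commute. Together with
  \<open>poly_act_linear_factor\<close>: if (X - z) r annihilates w, then r annihilates (A - z)
  w.\<close>

lemma poly_act_factor_commute:
  "poly_act A r (map_prod A A w - cmult z w) =
     map_prod A A (poly_act A r w) - cmult z (poly_act A r w)"
proof (induction r)
  case 0
  then show ?case by (simp add: poly_act_0 map_prod_zero)
next
  case (pCons a r)
  have m: "map_prod A A (v - w) = map_prod A A v - map_prod A A w" for v w
    using map_prod_add[of "v - w" w] by simp
  have c: "cmult b (v - w) = cmult b v - cmult b w" for b and v w :: "'a \<times> 'a"
    using cmult_add_right[of b "v - w" w] by simp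
  show ?case
    by (simp add: poly_act_pCons pCons.IH m c map_prod_add map_prod_cmult cmult_add_right
        cmult_cmult mult.commute)
qed

lemma poly_act_monom: "poly_act A (monom c i) w = cmult c ((map_prod A A ^^ i) w)"
  by (induction i) (simp_all add: monom_0 monom_Suc poly_act_pCons poly_act_0 map_prod_zero map_prod_cmult)

lemma poly_act_sum: "poly_act A (sum f I) w = (\<Sum>i\<in>I. poly_act A (f i) w)"
  by (induction I rule: infinite_finite_induct) (simp_all add: poly_act_0 poly_act_add)

lemma map_prod_funpow: "(map_prod A A ^^ i) (u, v) = ((A ^^ i) u, (A ^^ i) v)"
  by (induction i) auto

lemma poly_act_in:
  assumes T: "subspace T" "\<And>x. x \<in> T \<Longrightarrow> A x \<in> T" and w: "w \<in> T \<times> T"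
  shows "poly_act A p w \<in> T \<times> T"
proof (induction p)
  case 0
  then show ?case by (simp add: poly_act_0 zero_prod_def subspace_0[OF T(1)])
next
  case (pCons a p)
  then show ?case
    using w T by (cases w, cases "poly_act A p w")
      (auto simp: poly_act_pCons cmult_def intro!: subspace_add subspace_diff subspace_scale)
qed

end

text \<open>The iterates x, A x, ... up to the dimension are one vector too many to be
  independent.\<close>

lemma ex_annihilating_poly:
  fixes A :: "'a::euclidean_space \<Rightarrow> 'a"
  assumes A: "linear A"
  shows "\<exists>p. p \<noteq> 0 \<and> poly_act A p (x, 0) = 0"
proof -
  define f where "f i = (A ^^ i) x" for i :: nat
  have A0: "(A ^^ i) 0 = 0" for i
    by (induction i) (simp_all add: linear_0[OF A])
  have "\<exists>c. (\<exists>i\<le>DIM('a). c i \<noteq> 0) \<and> (\<Sum>i\<le>DIM('a). c i *\<^sub>R f i) = 0"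
  \<comment> \<open>Dependence is a property of the set of iterates and does not notice a repeated
    iterate; that case supplies the relation \<open>f i - f j = 0\<close> by itself.\<close>
  proof (cases "inj_on f {..DIM('a)}")
    case True
    then have "card (f ` {..DIM('a)}) > DIM('a)"
      by (simp add: card_image)
    then have "dependent (f ` {..DIM('a)})"
      by (meson dependent_biggerset finite_atMost finite_imageI)
    then obtain u v where u: "v \<in> f ` {..DIM('a)}" "u v \<noteq> 0" "(\<Sum>v\<in>f ` {..DIM('a)}. u v *\<^sub>R v) = 0"
      by (auto simp: dependent_finite)
    then show ?thesis
      by (intro exI[of _ "\<lambda>i. u (f i)"]) (auto simp: sum.reindex[OF True])
  next
    case False
    then obtain i j where ij: "i \<le> DIM('a)" "j \<le> DIM('a)" "i \<noteq> j" "f i = f j"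
      by (auto simp: inj_on_def)
    define c :: "nat \<Rightarrow> real" where "c k = (if k = i then 1 else 0) - (if k = j then 1 else 0)" for k
    have "(\<Sum>k\<le>DIM('a). c k *\<^sub>R f k) =
        (\<Sum>k\<le>DIM('a). if k = i then f k else 0) - (\<Sum>k\<le>DIM('a). if k = j then f k else 0)"
      unfolding sum_subtractf[symmetric] by (rule sum.cong) (auto simp: c_def)
    also have "\<dots> = 0" using ij by simp
    finally show ?thesis using ij by (intro exI[of _ c]) (auto simp: c_def intro!: exI[of _ i])
  qed
  then obtain c i where c: "i \<le> DIM('a)" "c i \<noteq> 0" "(\<Sum>i\<le>DIM('a). c i *\<^sub>R f i) = 0"
    by auto
  define p where "p = (\<Sum>i\<le>DIM('a). monom (complex_of_real (c i)) i)"
  have "coeff p i = c i"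
    using c(1) by (simp add: p_def coeff_sum)
  then have "p \<noteq> 0" using c(2) by auto
  moreover have "poly_act A p (x, 0) = (\<Sum>i\<le>DIM('a). (c i *\<^sub>R f i, 0))"
    unfolding p_def poly_act_sum[OF A] poly_act_monom[OF A] map_prod_funpow[OF A]
    by (simp add: cmult_def f_def A0)
  moreover have "\<dots> = (\<Sum>i\<le>DIM('a). c i *\<^sub>R f i, 0)"
    by (simp add: sum_prod)
  ultimately show ?thesis using c(3) by (intro exI[of _ p]) (auto simp: zero_prod_def)
qed

section \<open>Decay of iterates and the adapted norm\<close>

lemma contraction_with_null_forcing:
  fixes b e :: "nat \<Rightarrow> real"
  assumes r: "0 \<le> r" "r < 1" and b: "\<And>n. 0 \<le> b n"
    and rec: "\<And>n. b (Suc n) \<le> r * b n + e n" and e: "e \<longlonglongrightarrow> 0"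
  shows "b \<longlonglongrightarrow> 0"
proof (rule LIMSEQ_I)
  fix \<epsilon> :: real assume \<epsilon>: "0 < \<epsilon>"
  \<comment> \<open>With forcing below (1 - r) \<epsilon>/2, the value \<epsilon>/2 is a fixed point
    of the majorising recursion, so \<open>b\<close> exceeds it by at most a geometric term.\<close>
  have "\<forall>\<^sub>F n in sequentially. e n < (1 - r) * (\<epsilon> / 2)"
    using r \<epsilon> by (intro order_tendstoD(2)[OF e]) auto
  then obtain M where M: "\<And>n. n \<ge> M \<Longrightarrow> e n < (1 - r) * (\<epsilon> / 2)"
    by (auto simp: eventually_sequentially)
  have bnd: "b (M + k) \<le> r ^ k * b M + \<epsilon> / 2" for k
  proof (induction k)
    case 0
    then show ?case using \<epsilon> by simp
  next
    case (Suc k)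
    have "b (M + Suc k) \<le> r * b (M + k) + e (M + k)" using rec[of "M + k"] by simp
    also have "\<dots> \<le> r * (r ^ k * b M + \<epsilon> / 2) + (1 - r) * (\<epsilon> / 2)"
      using Suc r M[of "M + k"] by (intro add_mono mult_left_mono) auto
    also have "\<dots> = r ^ Suc k * b M + \<epsilon> / 2" by (simp add: field_simps)
    finally show ?case .
  qed
  have "(\<lambda>k. r ^ k * b M) \<longlonglongrightarrow> 0"
    using r by (intro tendsto_mult_left_zero LIMSEQ_power_zero) auto
  then have "\<forall>\<^sub>F k in sequentially. r ^ k * b M < \<epsilon> / 2"
    using \<epsilon> by (intro order_tendstoD(2)) auto
  then obtain K where K: "\<And>k. k \<ge> K \<Longrightarrow> r ^ k * b M < \<epsilon> / 2"
    by (auto simp: eventually_sequentially)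
  have "norm (b n - 0) < \<epsilon>" if "n \<ge> M + K" for n
  proof -
    from that obtain k where "n = M + k" "k \<ge> K" by (metis add_le_imp_le_left le_iff_add add_leD1)
    then show ?thesis using bnd[of k] K[of k] b[of n] by simp
  qed
  then show "\<exists>n0. \<forall>n\<ge>n0. norm (b n - 0) < \<epsilon>" by blast
qed

text \<open>A real supremum bounds its set only when the set is bounded above; a bound for
  \<open>A\<close> on the complexification bounds all eigenvalues.\<close>

lemma eigenvalue_less_spectral_radius:
  fixes A :: "'a::euclidean_space \<Rightarrow> 'a"
  assumes A: "linear A" and z: "z \<in> complex_eigenvalues_on T A"
  shows "cmod z \<le> spectral_radius_on T A"
proof -
  have "bounded_linear (map_prod A A :: 'a \<times> 'a \<Rightarrow> _)"
    using A by (intro linear_conv_bounded_linear[THEN iffD1] linearI)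
      (auto simp: linear_add linear_scale)
  then obtain K where K: "\<And>w. norm (map_prod A A w) \<le> norm w * K"
    using bounded_linear.bounded by blast
  have "cmod y \<le> K" if "y \<in> complex_eigenvalues_on T A" for y
  proof -
    from that obtain u v where w: "(u, v) \<noteq> 0" "map_prod A A (u, v) = cmult y (u, v)"
      by (auto simp: complex_eigenvalues_on_def cmult_def zero_prod_def)
    then have "cmod y * norm (u, v) \<le> norm (u, v) * K"
      using K[of "(u, v)"] by (simp only: norm_cmult)
    then show ?thesis using w(1) by (simp add: mult.commute)
  qed
  then have "bdd_above (cmod ` complex_eigenvalues_on T A)" by (auto intro!: bdd_aboveI[of _ K])
  then show ?thesis unfolding spectral_radius_on_def using z by (intro cSup_upper) auto
qed

text \<open>An annihilating polynomial is split into linear factors; a factor whose root is not an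
  eigenvalue is injective and can be dropped, and the remaining ones are treated one at a time.\<close>

lemma funpow_tendsto_zero:
  fixes A :: "'a::euclidean_space \<Rightarrow> 'a"
  assumes A: "linear A" and T: "subspace T" "\<And>x. x \<in> T \<Longrightarrow> A x \<in> T"
    and sr: "spectral_radius_on T A < 1" and x: "x \<in> T"
  shows "(\<lambda>n. (A ^^ n) x) \<longlonglongrightarrow> 0"
proof -
  let ?B = "map_prod A A :: 'a \<times> 'a \<Rightarrow> 'a \<times> 'a"
  have main: "(\<lambda>k. (?B ^^ k) w) \<longlonglongrightarrow> 0"
    if "degree p = n" "p \<noteq> 0" "w \<in> T \<times> T" "poly_act A p w = 0" for p n w
    using that
  proof (induction n arbitrary: p w)
    case 0
    then obtain a where a: "p = [:a:]" "a \<noteq> 0" by (metis degree_eq_zeroE pCons_0_0)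
    then have "cmult a w = 0" using 0 by (simp add: poly_act_pCons[OF A] poly_act_0[OF A] map_prod_zero[OF A])
    then have "w = 0" using a norm_cmult[of a w] by simp
    moreover have "(?B ^^ k) 0 = 0" for k
      by (induction k) (simp_all add: map_prod_zero[OF A])
    ultimately show ?case by simp
  next
    case (Suc n)
    then have "\<not> constant (poly p)" by (simp add: constant_degree)
    then obtain z where "poly p z = 0" using fundamental_theorem_of_algebra by blast
    then obtain r where r: "p = [:- z, 1:] * r" by (auto simp: poly_eq_0_iff_dvd elim: dvdE)
    then have r0: "r \<noteq> 0" using Suc.prems by auto
    then have deg: "degree r = n" using Suc.prems(1) unfolding r by (subst (asm) degree_mult_eq) auto
    define w' where "w' = ?B w - cmult z w"
    have w': "w' \<in> T \<times> T"
      using Suc.prems(3) T unfolding w'_def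
      by (cases w) (auto simp: cmult_def intro!: subspace_add subspace_diff subspace_scale)
    have B: "?B (poly_act A r w) = cmult z (poly_act A r w)"
      using Suc.prems(4) unfolding r poly_act_linear_factor[OF A] by simp
    show ?case
    proof (cases "cmod z < 1")
      case True
      \<comment> \<open>The induction hypothesis is applied to w' = (A - z) w. The orbit of w' then
        is a vanishing forcing term in the recursion for the orbit of w, which covers Jordan blocks
        without introducing them.\<close>
      have "poly_act A r w' = 0"
        unfolding w'_def poly_act_factor_commute[OF A] using B by simp
      then have lim: "(\<lambda>k. norm ((?B ^^ k) w')) \<longlonglongrightarrow> 0"
        using Suc.IH[OF deg r0 w'] by (simp add: tendsto_norm_zero)
      have Bw: "?B w = cmult z w + w'" by (simp add: w'_def)
      have rec: "(?B ^^ Suc k) w = cmult z ((?B ^^ k) w) + (?B ^^ k) w'" for k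
      proof (induction k)
        case 0
        then show ?case by (simp only: funpow.simps o_apply id_apply Bw)
      next
        case (Suc k)
        have "(?B ^^ Suc (Suc k)) w = ?B ((?B ^^ Suc k) w)" by simp
        also have "\<dots> = ?B (cmult z ((?B ^^ k) w) + (?B ^^ k) w')" unfolding Suc ..
        also have "\<dots> = cmult z ((?B ^^ Suc k) w) + (?B ^^ Suc k) w'"
          by (simp add: map_prod_add[OF A] map_prod_cmult[OF A])
        finally show ?case .
      qed
      have "(\<lambda>k. norm ((?B ^^ k) w)) \<longlonglongrightarrow> 0"
      proof (rule contraction_with_null_forcing[OF _ True _ _ lim])
        show "norm ((?B ^^ Suc k) w) \<le> cmod z * norm ((?B ^^ k) w) + norm ((?B ^^ k) w')" for k
          unfolding rec norm_cmult[symmetric] by (rule norm_triangle_ineq)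
      qed auto
      then show ?thesis by (simp add: tendsto_norm_zero_iff)
    next
      case False
      \<comment> \<open>Otherwise r(A) w would be an eigenvector in \<open>T\<close> whose
        eigenvalue has modulus at least one.\<close>
      have "poly_act A r w = 0"
      proof (rule ccontr)
        assume nz: "poly_act A r w \<noteq> 0"
        obtain u v where uv: "poly_act A r w = (u, v)" by fastforce
        then have "u \<in> T" "v \<in> T" using poly_act_in[OF A T Suc.prems(3), of r] by auto
        then have "z \<in> complex_eigenvalues_on T A"
          using B nz unfolding uv by (force simp: complex_eigenvalues_on_def cmult_def zero_prod_def)
        then show False using eigenvalue_less_spectral_radius[OF A] sr False by fastforce
      qed
      then show ?thesis using Suc.IH[OF deg r0] Suc.prems(3) by blast
    qed
  qed
  obtain p where "p \<noteq> 0" "poly_act A p (x, 0) = 0" using ex_annihilating_poly[OF A] by blast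
  then have "(\<lambda>k. (?B ^^ k) (x, 0)) \<longlonglongrightarrow> 0"
    using main x T(1) by (auto simp: subspace_0)
  from tendsto_fst[OF this] have "(\<lambda>k. fst ((?B ^^ k) (x, 0))) \<longlonglongrightarrow> 0" by simp
  then show ?thesis by (simp add: map_prod_funpow[OF A])
qed

text \<open>Take the sum of the norms of x, A x, ..., A^m x. Replacing x by A x drops the term
  \<open>norm x\<close> and adds the norm of A^(m+1) x, which is at most half of it for large m.
  Finite dimension turns pointwise decay into a common m.\<close>

lemma ex_adapted_norm:
  fixes A :: "'a::euclidean_space \<Rightarrow> 'a"
  assumes A: "linear A" and lim: "\<And>x. (\<lambda>n. (A ^^ n) x) \<longlonglongrightarrow> 0"
  obtains N :: "'a \<Rightarrow> real" and \<kappa> c where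
    "\<And>x y. N (x + y) \<le> N x + N y" "\<And>r x. N (r *\<^sub>R x) = \<bar>r\<bar> * N x"
    "\<And>x. norm x \<le> N x" "\<And>x. N x \<le> c * norm x" "\<And>x. N (A x) \<le> \<kappa> * N x"
    "0 \<le> \<kappa>" "\<kappa> < 1" "1 \<le> c"
proof -
  have lin: "linear (A ^^ n)" for n
    by (induction n) (auto intro: linear_compose[OF _ A, unfolded o_def] simp: linear_id[unfolded id_def] o_def A)
  \<comment> \<open>The dimension in the denominator is used up when the coordinates are summed,
    leaving the factor 1/2.\<close>
  have "\<exists>n0. \<forall>n\<ge>n0. \<forall>b\<in>Basis. norm ((A ^^ n) b) \<le> 1 / (2 * DIM('a))"
  proof -
    have "\<forall>\<^sub>F n in sequentially. norm ((A ^^ n) b) < 1 / (2 * DIM('a))" for b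
      by (rule order_tendstoD(2)[OF tendsto_norm_zero[OF lim]]) simp
    then have "\<forall>\<^sub>F n in sequentially. \<forall>b\<in>Basis. norm ((A ^^ n) b) < 1 / (2 * DIM('a))"
      by (simp add: eventually_ball_finite_distrib)
    then show ?thesis unfolding eventually_sequentially by (meson less_imp_le)
  qed
  then obtain m where m: "\<And>b. b \<in> Basis \<Longrightarrow> norm ((A ^^ Suc m) b) \<le> 1 / (2 * DIM('a))"
    by (meson le_SucI order_refl)
  have half: "norm ((A ^^ Suc m) x) \<le> norm x / 2" for x
  proof -
    have "(A ^^ Suc m) x = (\<Sum>b\<in>Basis. (x \<bullet> b) *\<^sub>R (A ^^ Suc m) b)"
      by (subst euclidean_representation[of x, symmetric])
         (simp only: linear_sum[OF lin] linear_scale[OF lin])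
    also have "norm \<dots> \<le> (\<Sum>b\<in>(Basis::'a set). norm x * (1 / (2 * DIM('a))))"
      using m
      by (intro order_trans[OF norm_sum] sum_mono)
         (auto simp only: norm_scaleR norm_ge_zero intro!: mult_mono Basis_le_norm)
    also have "\<dots> = norm x / 2" by simp
    finally show ?thesis .
  qed
  define N where "N x = (\<Sum>k<Suc m. norm ((A ^^ k) x))" for x
  have "\<exists>K. \<forall>x. norm ((A ^^ k) x) \<le> norm x * K" for k
    using lin[of k] bounded_linear.bounded linear_conv_bounded_linear by blast
  then obtain K where K: "\<And>k x. norm ((A ^^ k) x) \<le> norm x * K k" by metis
  define c where "c = 1 + (\<Sum>k<Suc m. \<bar>K k\<bar>)"
  have c1: "1 \<le> c" by (simp add: c_def sum_nonneg del: sum.lessThan_Suc)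
  have le_c: "N x \<le> c * norm x" for x
  proof -
    have "N x \<le> (\<Sum>k<Suc m. norm x * \<bar>K k\<bar>)"
      unfolding N_def by (intro sum_mono order_trans[OF K] mult_left_mono) auto
    also have "\<dots> \<le> c * norm x" by (simp add: c_def sum_distrib_left algebra_simps)
    finally show ?thesis .
  qed
  have ge: "norm x \<le> N x" for x
    unfolding N_def using member_le_sum[of 0 "{..<Suc m}" "\<lambda>k. norm ((A ^^ k) x)"] by simp
  have contr: "N (A x) \<le> (1 - 1 / (2 * c)) * N x" for x
  proof -
    have "N (A x) = (\<Sum>k<Suc m. norm ((A ^^ Suc k) x))"
      unfolding N_def by (simp only: funpow_Suc_right o_apply)
    also have "\<dots> = N x - norm x + norm ((A ^^ Suc m) x)"
      using sum_lessThan_telescope[of "\<lambda>k. norm ((A ^^ k) x)" "Suc m"]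
      unfolding N_def sum_subtractf by (simp del: funpow.simps sum.lessThan_Suc add: funpow_0)
    also have "\<dots> \<le> N x - norm x / 2" using half[of x] by simp
    \<comment> \<open>Equivalence of the norms turns the additive gain \<open>norm x / 2\<close>
      into the factor 1 - 1/(2c), which lies in [1/2, 1) because c is at least 1.\<close>
    also have "\<dots> \<le> N x - N x / (2 * c)" using le_c[of x] c1 by (simp add: field_simps)
    finally show ?thesis by (simp add: algebra_simps)
  qed
  show thesis
  proof (rule that[of N c "1 - 1 / (2 * c)"])
    show "N (x + y) \<le> N x + N y" for x y
      unfolding N_def sum.distrib[symmetric]
      by (intro sum_mono) (simp add: linear_add[OF lin] norm_triangle_ineq)
    show "N (r *\<^sub>R x) = \<bar>r\<bar> * N x" for r x
      unfolding N_def sum_distrib_left by (intro sum.cong) (simp_all add: linear_scale[OF lin])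
  qed (use le_c ge contr c1 in auto)
qed

section \<open>Local contraction of the message map\<close>

text \<open>For positive \<open>u\<close>, \<open>v\<close>: the logarithms differ by at most ln b.
  Such relative errors pass through products, quotients and positive sums with no lower bound on the
  entries, which suits normalised products.\<close>

definition within_factor :: "real \<Rightarrow> real \<Rightarrow> real \<Rightarrow> bool" where
  "within_factor b u v \<longleftrightarrow> u \<le> b * v \<and> v \<le> b * u"

lemma within_factor_refl: "1 \<le> b \<Longrightarrow> 0 \<le> u \<Longrightarrow> within_factor b u u"
  by (simp add: within_factor_def mult_le_cancel_right1)

lemma within_factor_mono:
  "within_factor b u v \<Longrightarrow> b \<le> c \<Longrightarrow> 0 \<le> u \<Longrightarrow> 0 \<le> v \<Longrightarrow> within_factor c u v"
  unfolding within_factor_def by (meson mult_right_mono order_trans)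

lemma within_factor_mult:
  assumes "within_factor b u v" "within_factor c u' v'" "0 \<le> b" "0 \<le> c"
    "0 \<le> u" "0 \<le> v" "0 \<le> u'" "0 \<le> v'"
  shows "within_factor (b * c) (u * u') (v * v')"
  using assms mult_mono[of u "b * v" u' "c * v'"] mult_mono[of v "b * u" v' "c * u'"]
  by (auto simp: within_factor_def algebra_simps)

lemma within_factor_inverse:
  assumes "within_factor b u v" "0 < u" "0 < v"
  shows "within_factor b (inverse u) (inverse v)"
  using assms by (auto simp: within_factor_def field_simps)

lemma within_factor_divide:
  assumes "within_factor b u v" "within_factor c u' v'" "0 \<le> b" "0 \<le> c"
    "0 \<le> u" "0 \<le> v" "0 < u'" "0 < v'"
  shows "within_factor (b * c) (u / u') (v / v')"
  unfolding divide_inverse using assms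
  by (intro within_factor_mult within_factor_inverse) auto

lemma within_factor_sum:
  assumes "\<And>i. i \<in> I \<Longrightarrow> within_factor b (u i) (v i)"
  shows "within_factor b (sum u I) (sum v I)"
  using assms by (auto simp: within_factor_def sum_distrib_left intro!: sum_mono)

lemma within_factor_prod:
  assumes "\<And>i. i \<in> I \<Longrightarrow> within_factor b (u i) (v i)" "0 \<le> b"
    "\<And>i. i \<in> I \<Longrightarrow> 0 \<le> u i" "\<And>i. i \<in> I \<Longrightarrow> 0 \<le> v i"
  shows "within_factor (b ^ card I) (prod u I) (prod v I)"
proof (cases "finite I")
  case True
  then show ?thesis using assms
  proof (induction I)
    case empty
    then show ?case by (simp add: within_factor_def)
  next
    case (insert i I)
    then show ?case by (auto intro!: within_factor_mult prod_nonneg)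
  qed
qed (simp add: within_factor_def)

lemma within_factor_abs_diff:
  assumes "within_factor b u v" "1 \<le> b" "0 \<le> u" "0 \<le> v"
  shows "\<bar>u - v\<bar> \<le> (b - 1) * v"
proof -
  have "v - u \<le> (b - 1) * v"
  proof -
    have "v \<le> b * u" using assms by (simp add: within_factor_def)
    \<comment> \<open>This is (b - 1)^2 v \<ge> 0. It replaces the lower bound v/b for
      \<open>u\<close> by (2 - b) v, so that both deviations have the same size.\<close>
    then have "b * (2 * v - b * v) \<le> v"
      using mult_right_mono[OF zero_le_power2[of "b - 1"] assms(4)]
      by (simp add: power2_eq_square algebra_simps)
    also have "\<dots> \<le> b * u" by fact
    finally have "2 * v - b * v \<le> u" using assms by simp
    then show ?thesis by (simp add: algebra_simps)
  qed
  then show ?thesis using assms by (auto simp: within_factor_def algebra_simps abs_le_iff)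
qed

lemma ex_factor_close_to_one:
  fixes X Y :: real
  assumes "0 < Y"
  shows "\<exists>b>1. (b ^ n - 1) * X \<le> Y"
proof -
  have "((\<lambda>b. (b ^ n - 1) * X) \<longlongrightarrow> (1 ^ n - 1) * X) (at_right (1::real))"
    by (intro tendsto_intros)
  then have "\<forall>\<^sub>F b in at_right (1::real). (b ^ n - 1) * X < Y"
    using assms by (intro order_tendstoD(2)) auto
  then obtain c where "c > 1" "\<And>b. 1 < b \<Longrightarrow> b < c \<Longrightarrow> (b ^ n - 1) * X < Y"
    unfolding eventually_at_right_field by auto
  moreover from this(1) obtain b where "1 < b" "b < c" using dense by blast
  ultimately show ?thesis by (intro exI[of _ b]) (auto simp: less_imp_le)
qed

lemma DERIV_prod_logarithmic:
  fixes f :: "'c \<Rightarrow> real \<Rightarrow> real"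
  assumes "finite C" "\<And>c. c \<in> C \<Longrightarrow> (f c has_real_derivative f' c) (at s)" "\<And>c. c \<in> C \<Longrightarrow> 0 < f c s"
  shows "((\<lambda>s. \<Prod>c\<in>C. f c s) has_real_derivative (\<Prod>c\<in>C. f c s) * (\<Sum>c\<in>C. f' c / f c s)) (at s)"
  using assms
proof (induction C)
  case empty
  then show ?case by simp
next
  case (insert c C)
  have "((\<lambda>s. f c s * (\<Prod>c\<in>C. f c s)) has_real_derivative
      f' c * (\<Prod>c\<in>C. f c s) + (\<Prod>c\<in>C. f c s) * (\<Sum>c\<in>C. f' c / f c s) * f c s) (at s)"
    using insert by (intro DERIV_mult) auto
  moreover have "f' c * P + P * S * f c s = f c s * P * (f' c / f c s + S)" for P S
    using insert.prems(2)[of c] by (simp add: field_simps)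
  ultimately show ?case using insert(1,2) by simp
qed

section \<open>Messages, their derivatives and the mean value estimate\<close>

definition normalized :: "real^'s \<Rightarrow> real^'s" where
  "normalized v = (1 / (\<Sum>i\<in>UNIV. v $ i)) *\<^sub>R v"

text \<open>An unnormalised belief propagation update at a vertex with field \<open>g\<close>. The
  index type stays open: the derivative of the boundary map is computed over \<open>{..<d}\<close>,
  whereas the tree uses sets of children.\<close>

definition message_weight :: "real^'s^'s \<Rightarrow> real^'s \<Rightarrow> 'c set \<Rightarrow> ('c \<Rightarrow> real^'s) \<Rightarrow> real^'s" where
  "message_weight Q g C m = (\<chi> k. g $ k * (\<Prod>c\<in>C. (Q *v m c) $ k))"

definition message :: "real^'s^'s \<Rightarrow> real^'s \<Rightarrow> 'c set \<Rightarrow> ('c \<Rightarrow> real^'s) \<Rightarrow> real^'s" where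
  "message Q g C m = normalized (message_weight Q g C m)"

lemma message_weight_cong:
  "g = g' \<Longrightarrow> C = C' \<Longrightarrow> (\<And>c. c \<in> C' \<Longrightarrow> m c = m' c) \<Longrightarrow> message_weight Q g C m = message_weight Q g' C' m'"
  unfolding message_weight_def by (simp cong: prod.cong)

lemma normalized_scaleR: "c \<noteq> 0 \<Longrightarrow> normalized (c *\<^sub>R v) = normalized v"
  by (simp add: normalized_def sum_distrib_left[symmetric])

lemma message_scale_field: "c \<noteq> 0 \<Longrightarrow> message Q (c *\<^sub>R g) C m = message Q g C m"
proof -
  assume "c \<noteq> 0"
  moreover have "message_weight Q (c *\<^sub>R g) C m = c *\<^sub>R message_weight Q g C m"
    by (simp add: message_weight_def vec_eq_iff)
  ultimately show ?thesis by (simp add: message_def normalized_scaleR)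
qed

text \<open>Rescaling an incoming message rescales the whole weight vector, which the outer
  normalisation undoes. So the unnormalised weights of partition sums may be normalised at every
  vertex.\<close>

lemma message_normalized:
  fixes m :: "'c \<Rightarrow> real^'s"
  assumes "\<And>c i. c \<in> C \<Longrightarrow> 0 < m c $ i"
  shows "message Q g C (\<lambda>c. normalized (m c)) = message Q g C m"
proof (cases "finite C")
  case True
  define r where "r = (\<Prod>c\<in>C. 1 / (\<Sum>i\<in>UNIV. m c $ i))"
  have "message_weight Q g C (\<lambda>c. normalized (m c)) = r *\<^sub>R message_weight Q g C m"
    by (simp add: message_weight_def vec_eq_iff normalized_def matrix_vector_mult_scaleR
        prod.distrib r_def prod_dividef)
  moreover have "(\<Sum>i\<in>UNIV. m c $ i) \<noteq> 0" if "c \<in> C" for c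
    using assms[OF that] by (intro less_imp_neq[THEN not_sym] sum_pos) auto
  then have "r \<noteq> 0" using True by (simp add: r_def)
  ultimately show ?thesis by (simp add: message_def normalized_scaleR)
qed (simp add: message_def message_weight_def)

context
  fixes Q :: "real^'s^'s"
begin

lemma message_weight_pos:
  assumes "\<And>k. 0 < g $ k" "\<And>c k. c \<in> C \<Longrightarrow> 0 < (Q *v m c) $ k"
  shows "0 < message_weight Q g C m $ k"
  using assms by (auto simp: message_weight_def intro!: mult_pos_pos prod_pos)

lemma message_pos:
  assumes "\<And>k. 0 < g $ k" "\<And>c k. c \<in> C \<Longrightarrow> 0 < (Q *v m c) $ k"
  shows "0 < message Q g C m $ k"
  using message_weight_pos[OF assms]
  by (auto simp: message_def normalized_def intro!: divide_pos_pos sum_pos)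

lemma sum_message:
  assumes "\<And>k. 0 < g $ k" "\<And>c k. c \<in> C \<Longrightarrow> 0 < (Q *v m c) $ k"
  shows "(\<Sum>k\<in>UNIV. message Q g C m $ k) = 1"
proof -
  have "0 < (\<Sum>k\<in>UNIV. message_weight Q g C m $ k)"
    using message_weight_pos[OF assms] by (intro sum_pos) auto
  then show ?thesis by (simp add: message_def normalized_def sum_divide_distrib[symmetric])
qed

text \<open>The square appears because the numerator and the normalising sum may each be off by
  \<open>\<gamma> * \<beta> ^ card C\<close>.\<close>

lemma message_within_factor:
  assumes g: "\<And>k. within_factor \<gamma> (g $ k) (g' $ k)" "\<And>k. 0 < g $ k" "\<And>k. 0 < g' $ k"
    and m: "\<And>c k. c \<in> C \<Longrightarrow> within_factor \<beta> ((Q *v m c) $ k) ((Q *v m' c) $ k)"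
      "\<And>c k. c \<in> C \<Longrightarrow> 0 < (Q *v m c) $ k" "\<And>c k. c \<in> C \<Longrightarrow> 0 < (Q *v m' c) $ k"
    and "0 \<le> \<gamma>" "0 \<le> \<beta>"
  shows "within_factor ((\<gamma> * \<beta> ^ card C)\<^sup>2) (message Q g C m $ k) (message Q g' C m' $ k)"
proof -
  have w: "within_factor (\<gamma> * \<beta> ^ card C) (message_weight Q g C m $ j) (message_weight Q g' C m' $ j)" for j
    unfolding message_weight_def using assms
    by (auto intro!: within_factor_mult within_factor_prod prod_nonneg simp: less_imp_le)
  then have s: "within_factor (\<gamma> * \<beta> ^ card C) (\<Sum>j\<in>UNIV. message_weight Q g C m $ j)
      (\<Sum>j\<in>UNIV. message_weight Q g' C m' $ j)"
    by (intro within_factor_sum)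
  have pos: "0 < message_weight Q g C m $ j" "0 < message_weight Q g' C m' $ j" for j
    using g m by (auto intro!: message_weight_pos)
  then have "0 < (\<Sum>j\<in>UNIV. message_weight Q g C m $ j)" "0 < (\<Sum>j\<in>UNIV. message_weight Q g' C m' $ j)"
    by (auto intro!: sum_pos)
  then show ?thesis
    using within_factor_divide[OF w s, of k] pos assms(7,8)
    by (simp add: message_def normalized_def power2_eq_square less_imp_le)
qed

text \<open>The derivative of a message with respect to one incoming message, in terms of the current
  value \<open>p\<close> of the message and \<open>h = Q m\<close> for the incoming message \<open>m\<close>.\<close>

definition message_deriv :: "real^'s \<Rightarrow> real^'s \<Rightarrow> real^'s \<Rightarrow> real^'s" where
  "message_deriv p h y = (\<chi> k. p $ k * (y $ k / h $ k - (\<Sum>j\<in>UNIV. p $ j * (y $ j / h $ j))))"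

text \<open>Logarithmic differentiation: if W_k' = W_k D_k, then the normalised vector p has
  derivative p_k (D_k - sum_j p_j D_j). As D_k is a sum over the incoming messages, their
  contributions add up.\<close>

lemma message_has_derivative_on_line:
  fixes a b :: "'c \<Rightarrow> real^'s"
  assumes C: "finite C" and g: "\<And>k. 0 < g $ k"
    and pos: "\<And>c k. c \<in> C \<Longrightarrow> 0 < (Q *v (a c + s *\<^sub>R b c)) $ k"
  shows "((\<lambda>s. message Q g C (\<lambda>c. a c + s *\<^sub>R b c) $ k) has_real_derivative
    (\<Sum>c\<in>C. message_deriv (message Q g C (\<lambda>c. a c + s *\<^sub>R b c)) (Q *v (a c + s *\<^sub>R b c)) (Q *v b c) $ k)) (at s)"
proof -
  define W where "W k s = message_weight Q g C (\<lambda>c. a c + s *\<^sub>R b c) $ k" for k s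
  define r where "r c k = (Q *v b c) $ k / (Q *v (a c + s *\<^sub>R b c)) $ k" for c k
  define D where "D k = (\<Sum>c\<in>C. r c k)" for k
  define Z where "Z s = (\<Sum>k\<in>UNIV. W k s)" for s
  have Wpos: "0 < W k s" for k
    unfolding W_def using g pos by (intro message_weight_pos)
  then have Zpos: "0 < Z s" unfolding Z_def by (intro sum_pos) auto
  have lin: "((\<lambda>s. (Q *v (a c + s *\<^sub>R b c)) $ k) has_real_derivative (Q *v b c) $ k) (at s)" for c k
    by (auto simp: matrix_vector_right_distrib matrix_vector_mult_scaleR intro!: derivative_eq_intros)
  have "((\<lambda>s. \<Prod>c\<in>C. (Q *v (a c + s *\<^sub>R b c)) $ k) has_real_derivative
      (\<Prod>c\<in>C. (Q *v (a c + s *\<^sub>R b c)) $ k) * (\<Sum>c\<in>C. r c k)) (at s)" for k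
    unfolding r_def using C lin pos by (intro DERIV_prod_logarithmic) auto
  then have W: "(W k has_real_derivative W k s * D k) (at s)" for k
    unfolding W_def message_weight_def D_def
    by (auto intro!: derivative_eq_intros simp: mult.assoc)
  have Z: "(Z has_real_derivative (\<Sum>j\<in>UNIV. W j s * D j)) (at s)"
    unfolding Z_def using W by (intro DERIV_sum)
  have msg: "message Q g C (\<lambda>c. a c + s *\<^sub>R b c) $ k = W k s / Z s" for k s
    by (simp add: message_def normalized_def W_def Z_def)
  have "((\<lambda>s. W k s / Z s) has_real_derivative
      (W k s * D k * Z s - W k s * (\<Sum>j\<in>UNIV. W j s * D j)) / (Z s * Z s)) (at s)"
    using Zpos by (intro DERIV_divide W Z) auto
  also have "(W k s * D k * Z s - W k s * (\<Sum>j\<in>UNIV. W j s * D j)) / (Z s * Z s) =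
      W k s / Z s * (D k - (\<Sum>j\<in>UNIV. W j s / Z s * D j))"
    using Zpos by (simp add: field_simps sum_divide_distrib[symmetric])
  also have "(\<Sum>j\<in>UNIV. W j s / Z s * D j) = (\<Sum>c\<in>C. \<Sum>j\<in>UNIV. W j s / Z s * r c j)"
    unfolding D_def sum_distrib_left by (rule sum.swap)
  also have "W k s / Z s * (D k - (\<Sum>c\<in>C. \<Sum>j\<in>UNIV. W j s / Z s * r c j)) =
      (\<Sum>c\<in>C. W k s / Z s * (r c k - (\<Sum>j\<in>UNIV. W j s / Z s * r c j)))"
    by (simp only: D_def sum_subtractf[symmetric] sum_distrib_left)
  finally show ?thesis
    unfolding message_deriv_def by (simp add: msg r_def)
qed

text \<open>As a linear form in \<open>y\<close> the derivative has coefficients built from p_k /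
  h_k and p_k p_j / h_j. The second kind contains p twice and h once, whence the factor
  \<open>b * b * \<beta>\<close>.\<close>

lemma message_deriv_perturbation:
  assumes p: "\<And>j. within_factor b (p $ j) (l $ j)"
    and h: "\<And>j. within_factor \<beta> (h $ j) (h0 $ j)"
    and pos: "\<And>j. 0 < p $ j" "\<And>j. 0 < l $ j" "\<And>j. 0 < h $ j" "\<And>j. 0 < h0 $ j"
    and b: "1 \<le> b" "1 \<le> \<beta>"
  shows "\<bar>message_deriv p h y $ k - message_deriv l h0 y $ k\<bar> \<le>
    (b * b * \<beta> - 1) * (l $ k * (\<bar>y $ k\<bar> / h0 $ k + (\<Sum>j\<in>UNIV. l $ j * (\<bar>y $ j\<bar> / h0 $ j))))"
proof -
  let ?e = "b * b * \<beta> - 1"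
  have bb: "1 \<le> b * b" "1 \<le> b * b * \<beta>" "b * \<beta> \<le> b * b * \<beta>"
    using b mult_mono[of 1 b 1 b] mult_mono[of 1 "b * b" 1 \<beta>] by (auto simp: mult_le_cancel_right1)
  have "within_factor (b * \<beta>) (p $ k / h $ k) (l $ k / h0 $ k)"
    using assms by (intro within_factor_divide) (auto simp: less_imp_le)
  then have w1: "within_factor (b * b * \<beta>) (p $ k / h $ k) (l $ k / h0 $ k)"
    using bb pos by (elim within_factor_mono) (auto simp: less_imp_le)
  have w2: "within_factor (b * b * \<beta>) (p $ k * p $ j / h $ j) (l $ k * l $ j / h0 $ j)" for j
    using assms by (intro within_factor_divide within_factor_mult) (auto simp: less_imp_le)
  have 1: "\<bar>p $ k / h $ k - l $ k / h0 $ k\<bar> \<le> ?e * (l $ k / h0 $ k)"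
    using bb pos by (intro within_factor_abs_diff[OF w1]) (auto simp: less_imp_le)
  have 2: "\<bar>p $ k * p $ j / h $ j - l $ k * l $ j / h0 $ j\<bar> \<le> ?e * (l $ k * l $ j / h0 $ j)" for j
    using bb pos by (intro within_factor_abs_diff[OF w2]) (auto simp: less_imp_le)
  have exp: "message_deriv p' h' y $ k = p' $ k / h' $ k * y $ k - (\<Sum>j\<in>UNIV. p' $ k * p' $ j / h' $ j * y $ j)" for p' h'
    by (simp add: message_deriv_def right_diff_distrib sum_distrib_left mult.assoc)
  have "message_deriv p h y $ k - message_deriv l h0 y $ k =
     (p $ k / h $ k - l $ k / h0 $ k) * y $ k
      - (\<Sum>j\<in>UNIV. (p $ k * p $ j / h $ j - l $ k * l $ j / h0 $ j) * y $ j)"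
    unfolding exp by (simp add: left_diff_distrib sum_subtractf)
  also have "\<bar>\<dots>\<bar> \<le> \<bar>(p $ k / h $ k - l $ k / h0 $ k) * y $ k\<bar>
      + \<bar>\<Sum>j\<in>UNIV. (p $ k * p $ j / h $ j - l $ k * l $ j / h0 $ j) * y $ j\<bar>"
    by (rule abs_triangle_ineq4)
  also have "\<dots> \<le> ?e * (l $ k / h0 $ k) * \<bar>y $ k\<bar>
      + (\<Sum>j\<in>UNIV. ?e * (l $ k * l $ j / h0 $ j) * \<bar>y $ j\<bar>)"
    unfolding abs_mult
    by (intro add_mono order_trans[OF sum_abs] sum_mono order_trans[OF eq_refl[OF abs_mult]]
        mult_right_mono 1 2 abs_ge_zero)
  also have "\<dots> = ?e * (l $ k * (\<bar>y $ k\<bar> / h0 $ k + (\<Sum>j\<in>UNIV. l $ j * (\<bar>y $ j\<bar> / h0 $ j))))"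
    by (simp add: sum_distrib_left distrib_left mult.assoc)
  finally show ?thesis .
qed

text \<open>The increment is compared with the linearisation at (1, l, ..., l) instead of at
  \<open>m'\<close>, so the leading term is the same operator for all fields and messages. The
  intermediate point \<open>s\<close> depends on the coordinate \<open>k\<close>, but the bound does
  not depend on \<open>s\<close>.\<close>

lemma message_mean_value:
  fixes m m' :: "'c \<Rightarrow> real^'s"
  assumes C: "finite C" and g: "\<And>k. 0 < g $ k" "\<And>k. within_factor \<beta> (g $ k) 1" and \<beta>: "1 \<le> \<beta>"
    and l: "\<And>k. 0 < (Q *v l) $ k" "\<And>k. 0 < l $ k" "message Q 1 C (\<lambda>_. l) = l"
    and m: "\<And>c k. c \<in> C \<Longrightarrow> 0 < (Q *v m c) $ k"
      "\<And>c k. c \<in> C \<Longrightarrow> within_factor \<beta> ((Q *v m c) $ k) ((Q *v l) $ k)"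
    and m': "\<And>c k. c \<in> C \<Longrightarrow> 0 < (Q *v m' c) $ k"
      "\<And>c k. c \<in> C \<Longrightarrow> within_factor \<beta> ((Q *v m' c) $ k) ((Q *v l) $ k)"
  shows "\<bar>message Q g C m $ k - message Q g C m' $ k
      - (\<Sum>c\<in>C. message_deriv l (Q *v l) (Q *v (m c - m' c)) $ k)\<bar> \<le>
    (\<Sum>c\<in>C. (\<beta> ^ (4 * card C + 5) - 1) * (l $ k * (\<bar>(Q *v (m c - m' c)) $ k\<bar> / (Q *v l) $ k +
       (\<Sum>j\<in>UNIV. l $ j * (\<bar>(Q *v (m c - m' c)) $ j\<bar> / (Q *v l) $ j)))))"
proof -
  define x where "x s c = m' c + s *\<^sub>R (m c - m' c)" for s c
  define f where "f s = message Q g C (x s) $ k" for s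
  define f' where "f' s = (\<Sum>c\<in>C. message_deriv (message Q g C (x s)) (Q *v x s c) (Q *v (m c - m' c)) $ k)" for s
  have Qx: "(Q *v x s c) $ j = (1 - s) * (Q *v m' c) $ j + s * (Q *v m c) $ j" for s c j
    by (simp add: x_def matrix_vector_right_distrib matrix_vector_mult_scaleR
        matrix_vector_mult_diff_distrib algebra_simps)
  have pos: "0 < (Q *v x s c) $ j" if "0 \<le> s" "s \<le> 1" "c \<in> C" for s c j
    using that m m' unfolding Qx
    by (cases "s = 0") (auto intro!: add_nonneg_pos mult_nonneg_nonneg simp: less_imp_le)
  \<comment> \<open>Both inequalities of \<open>within_factor\<close> are linear in the compared
    pair and hence survive convex combinations along the segment.\<close>
  have wf: "within_factor \<beta> ((Q *v x s c) $ j) ((Q *v l) $ j)" if "0 \<le> s" "s \<le> 1" "c \<in> C" for s c j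
  proof -
    have "within_factor \<beta> ((Q *v x s c) $ j) ((1 - s) * (Q *v l) $ j + s * (Q *v l) $ j)"
      using m(2)[OF that(3), of j] m'(2)[OF that(3), of j] that(1,2)
        mult_left_mono[of _ _ s] mult_left_mono[of _ _ "1 - s"]
      unfolding Qx within_factor_def distrib_left mult.left_commute[of \<beta>]
      by (intro conjI add_mono mult_left_mono) auto
    then show ?thesis by (simp add: algebra_simps)
  qed
  have "(f has_real_derivative f' s) (at s)" if "0 \<le> s" "s \<le> 1" for s
    unfolding f_def f'_def x_def
    using message_has_derivative_on_line[OF C g(1), of m' s "\<lambda>c. m c - m' c" k] pos[OF that]
    by (simp add: x_def)
  then obtain s where s: "0 < s" "s < 1" "f 1 - f 0 = (1 - 0) * f' s"
    using MVT2[of 0 1 f f'] by auto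
  define p where "p = message Q g C (x s)"
  have ppos: "0 < p $ j" for j
    unfolding p_def using g pos s by (intro message_pos) auto
  have "within_factor ((\<beta> * \<beta> ^ card C)\<^sup>2) (message Q g C (x s) $ j) (message Q 1 C (\<lambda>_. l) $ j)" for j
    using g pos wf s l \<beta> by (intro message_within_factor) auto
  then have pl: "within_factor ((\<beta> * \<beta> ^ card C)\<^sup>2) (p $ j) (l $ j)" for j
    unfolding p_def l(3) .
  \<comment> \<open>Each of the two factors p costs 2 (card C + 1) powers of \<beta> and h costs one
    more.\<close>
  have e: "(\<beta> * \<beta> ^ card C)\<^sup>2 * (\<beta> * \<beta> ^ card C)\<^sup>2 * \<beta> = \<beta> ^ (4 * card C + 5)"
  proof -
    have "\<beta> ^ (4 * card C + 5) = (\<beta> ^ card C) ^ 4 * \<beta> ^ 5"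
      unfolding power_add power_mult[symmetric] by (simp add: mult.commute)
    moreover have "(\<beta> * u)\<^sup>2 * (\<beta> * u)\<^sup>2 * \<beta> = u ^ 4 * \<beta> ^ 5" for u
      by (simp add: eval_nat_numeral mult_ac)
    ultimately show ?thesis by simp
  qed
  have b1: "1 \<le> (\<beta> * \<beta> ^ card C)\<^sup>2"
    using \<beta> by (metis one_le_power power_Suc)
  have "message Q g C m $ k - message Q g C m' $ k = f' s"
  proof -
    have "x 1 = m" "x 0 = m'" by (simp_all add: x_def fun_eq_iff)
    then show ?thesis using s(3) by (simp add: f_def)
  qed
  then have "\<bar>message Q g C m $ k - message Q g C m' $ k
      - (\<Sum>c\<in>C. message_deriv l (Q *v l) (Q *v (m c - m' c)) $ k)\<bar> =
    \<bar>\<Sum>c\<in>C. message_deriv p (Q *v x s c) (Q *v (m c - m' c)) $ k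
      - message_deriv l (Q *v l) (Q *v (m c - m' c)) $ k\<bar>"
    by (simp add: f'_def p_def sum_subtractf)
  also have "\<dots> \<le> (\<Sum>c\<in>C. (\<beta> ^ (4 * card C + 5) - 1) * (l $ k * (\<bar>(Q *v (m c - m' c)) $ k\<bar> / (Q *v l) $ k +
       (\<Sum>j\<in>UNIV. l $ j * (\<bar>(Q *v (m c - m' c)) $ j\<bar> / (Q *v l) $ j)))))"
    unfolding e[symmetric] using s pos wf ppos l b1 \<beta>
    by (intro order_trans[OF sum_abs] sum_mono message_deriv_perturbation pl) auto
  finally show ?thesis .
qed

end

lemma message_fixed_point:
  fixes Q :: "real^'s^'s"
  assumes Q: "\<And>i j. 0 < Q $ i $ j" and l: "boundary_law d Q l" and C: "card C = d"
  shows "message Q 1 C (\<lambda>_. l) = l"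
proof -
  have pos: "\<And>i. 0 < l $ i" using l by (simp add: boundary_law_def)
  have "boundary_map d Q l = message Q 1 C (\<lambda>_. l)"
    using boundary_map_eq_near[OF Q pos, THEN eventually_nhds_x_imp_x]
    by (simp add: message_def normalized_def message_weight_def C vec_eq_iff)
  then show ?thesis using l by (simp add: boundary_law_def)
qed

text \<open>The differential is determined by derivatives along lines through \<open>l\<close>,
  which are unique. Moving the argument of the boundary map moves all \<open>d\<close> incoming
  messages at once, and each contributes the same term.\<close>

lemma boundary_map_derivative:
  fixes Q :: "real^'s^'s"
  assumes Q: "\<And>i j. 0 < Q $ i $ j" and l: "boundary_law d Q l"
  shows "frechet_derivative (boundary_map d Q) (at l) x = real d *\<^sub>R message_deriv l (Q *v l) (Q *v x)"
proof -
  let ?A = "frechet_derivative (boundary_map d Q) (at l)"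
  have pos: "\<And>i. 0 < l $ i" using l by (simp add: boundary_law_def)
  have "(boundary_map d Q has_derivative ?A) (at l)"
    using boundary_map_differentiable[OF Q pos] frechet_derivative_works by blast
  moreover have line: "((\<lambda>s. l + s *\<^sub>R x) has_derivative (\<lambda>s. s *\<^sub>R x)) (at 0)"
    by (auto intro!: derivative_eq_intros)
  ultimately have "((\<lambda>s. boundary_map d Q (l + s *\<^sub>R x)) has_derivative (\<lambda>s. ?A (s *\<^sub>R x))) (at 0)"
    using has_derivative_compose[OF line, of "boundary_map d Q" ?A] by simp
  then have 1: "((\<lambda>s. boundary_map d Q (l + s *\<^sub>R x) $ k) has_derivative (\<lambda>s. ?A (s *\<^sub>R x) $ k)) (at 0)" for k
    by (rule bounded_linear.has_derivative[OF bounded_linear_vec_nth])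
  have "?A (s *\<^sub>R x) $ k = ?A x $ k * s" for s k
    using linear_frechet_derivative[OF boundary_map_differentiable[OF Q pos]]
    by (simp add: linear_scale)
  then have d1: "((\<lambda>s. boundary_map d Q (l + s *\<^sub>R x) $ k) has_real_derivative ?A x $ k) (at 0)" for k
    using 1[of k] by (simp add: has_field_derivative_def)
  have ev: "\<forall>\<^sub>F s in nhds (0::real). boundary_map d Q (l + s *\<^sub>R x) = message Q 1 {..<d} (\<lambda>_. l + s *\<^sub>R x)"
  proof -
    have "\<forall>\<^sub>F y in nhds l. boundary_map d Q y = message Q 1 {..<d} (\<lambda>_. y)"
      using boundary_map_eq_near[OF Q pos, of d]
      by eventually_elim (simp add: message_def normalized_def message_weight_def vec_eq_iff)
    moreover have "((\<lambda>s. l + s *\<^sub>R x) \<longlongrightarrow> l) (nhds 0)"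
      by (auto intro!: tendsto_eq_intros filterlim_ident)
    ultimately show ?thesis by (rule eventually_compose_filterlim)
  qed
  have "((\<lambda>s. message Q 1 {..<d} (\<lambda>_. l + s *\<^sub>R x) $ k) has_real_derivative
      real d * message_deriv l (Q *v l) (Q *v x) $ k) (at 0)" for k
    using message_has_derivative_on_line[of "{..<d}" 1 Q "\<lambda>_. l" 0 "\<lambda>_. x" k]
      matrix_vector_pos[OF Q pos] message_fixed_point[OF Q l, of "{..<d}"]
    by simp
  moreover have "\<forall>\<^sub>F s in nhds 0. boundary_map d Q (l + s *\<^sub>R x) $ k = message Q 1 {..<d} (\<lambda>_. l + s *\<^sub>R x) $ k" for k
    using ev by eventually_elim simp
  ultimately have "((\<lambda>s. boundary_map d Q (l + s *\<^sub>R x) $ k) has_real_derivative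
      real d * message_deriv l (Q *v l) (Q *v x) $ k) (at 0)" for k
    by (subst DERIV_cong_ev[OF refl _ refl])
  with d1 show ?thesis by (auto simp: vec_eq_iff intro: DERIV_unique)
qed

text \<open>\<open>B\<close> stands for the maximum over \<open>C\<close> of the distances between
  incoming messages. Both updates carry the same field \<open>g\<close>, as happens at sites where
  two conditionings agree.\<close>

definition contracts_near ::
  "real^'s^'s \<Rightarrow> real^'s \<Rightarrow> (real^'s \<Rightarrow> real) \<Rightarrow> real \<Rightarrow> real \<Rightarrow> real \<Rightarrow> 'c set \<Rightarrow> bool" where
  "contracts_near Q l N \<kappa> \<rho> \<gamma> C \<longleftrightarrow>
    (\<forall>g m m' B. (\<forall>k. 0 < g $ k \<and> within_factor \<gamma> (g $ k) 1) \<longrightarrow> (\<forall>c\<in>C. N (m c - l) \<le> \<rho>) \<longrightarrow>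
      N (message Q g C m - l) \<le> \<rho> \<and>
      ((\<forall>c\<in>C. N (m' c - l) \<le> \<rho> \<and> N (m c - m' c) \<le> B) \<longrightarrow> 0 \<le> B \<longrightarrow>
        N (message Q g C m - message Q g C m') \<le> \<kappa> * B))"

text \<open>For the adapted norm the mean value estimate splits into the contracting linear part, shared
  equally by the \<open>d\<close> incoming messages, and a remainder that is small near \<open>(1, l, \<dots>, l)\<close>.\<close>

lemma message_local_contraction:
  fixes Q :: "real^'s^'s" and l :: "real^'s"
  assumes Q: "\<And>i j. 0 < Q $ i $ j" and l: "boundary_law d Q l" and st: "boundary_law_stable d Q l"
  obtains N :: "real^'s \<Rightarrow> real" and \<kappa> \<rho> \<gamma> where
    "\<And>x y. N (x + y) \<le> N x + N y" "\<And>x. N (- x) = N x" "\<And>x. norm x \<le> N x" "N 0 = 0"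
    "0 \<le> \<kappa>" "\<kappa> < 1" "0 < \<rho>" "1 < \<gamma>"
    "\<forall>C::'c set. finite C \<and> card C = d \<longrightarrow> contracts_near Q l N \<kappa> \<rho> \<gamma> C"
proof -
  define A where "A = frechet_derivative (boundary_map d Q) (at l)"
  have pos: "\<And>i. 0 < l $ i" and l1: "(\<Sum>i\<in>UNIV. l $ i) = 1"
    using l by (simp_all add: boundary_law_def prob_simplex_def)
  have A: "linear A"
    unfolding A_def by (intro linear_frechet_derivative boundary_map_differentiable Q pos)
  have AT: "A x \<in> simplex_tangent" for x
    unfolding A_def by (intro boundary_map_derivative_tangent Q pos)
  have T: "subspace (simplex_tangent :: (real^'s) set)"
    by (auto simp: subspace_def simplex_tangent_def sum.distrib sum_distrib_left[symmetric])
  \<comment> \<open>One application of \<open>A\<close> leads into the tangent space, so decay there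
    gives decay everywhere and the adapted norm can be defined on all of
    \<open>real^'s\<close>.\<close>
  have lim: "(\<lambda>n. (A ^^ n) x) \<longlonglongrightarrow> 0" for x
  proof -
    have "(\<lambda>n. (A ^^ n) (A x)) \<longlonglongrightarrow> 0"
      using st AT by (intro funpow_tendsto_zero[OF A T]) (auto simp: boundary_law_stable_def A_def)
    then have "(\<lambda>n. (A ^^ Suc n) x) \<longlonglongrightarrow> 0" by (simp only: funpow_Suc_right o_apply)
    then show ?thesis by (rule LIMSEQ_imp_Suc)
  qed
  obtain N :: "real^'s \<Rightarrow> real" and \<kappa> c where
    N: "\<And>x y. N (x + y) \<le> N x + N y" "\<And>r x. N (r *\<^sub>R x) = \<bar>r\<bar> * N x"
    "\<And>x. norm x \<le> N x" "\<And>x. N x \<le> c * norm x" "\<And>x. N (A x) \<le> \<kappa> * N x"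
    "0 \<le> \<kappa>" "\<kappa> < 1" "1 \<le> c"
    by (rule ex_adapted_norm[OF A lim]) (rule that)
  have N0: "N 0 = 0" using N(2)[of 0 0] by simp
  have Nm: "N (- x) = N x" for x using N(2)[of "- 1" x] by simp
  have Nsum: "N (\<Sum>i\<in>I. f i) \<le> (\<Sum>i\<in>I. N (f i))" for f and I :: "'c set"
    by (induction I rule: infinite_finite_induct) (auto simp: N0 intro: order_trans[OF N(1)])
  define h where "h = Q *v l"
  have hpos: "0 < h $ k" for k unfolding h_def by (rule matrix_vector_pos[OF Q pos])
  obtain K0 where K0: "0 < K0" "\<And>x. norm (Q *v x) \<le> norm x * K0"
    using bounded_linear.pos_bounded[OF matrix_vector_mul_bounded_linear[of Q]] by blast
  \<comment> \<open>The bracket of \<open>message_mean_value\<close>, summed over \<open>k\<close>,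
    is at most \<open>K\<close> times the length of the increment.\<close>
  define K where "K = (\<Sum>k\<in>UNIV. l $ k * (K0 / h $ k + (\<Sum>j\<in>UNIV. l $ j * (K0 / h $ j))))"
  have Kb: "(\<Sum>k\<in>UNIV. l $ k * (\<bar>(Q *v x) $ k\<bar> / h $ k + (\<Sum>j\<in>UNIV. l $ j * (\<bar>(Q *v x) $ j\<bar> / h $ j)))) \<le> K * norm x" for x
  proof -
    have "\<bar>(Q *v x) $ k\<bar> \<le> norm x * K0" for k
      using component_le_norm_cart[of "Q *v x" k] K0(2)[of x] by simp
    then have "\<bar>(Q *v x) $ k\<bar> / h $ k \<le> K0 / h $ k * norm x" for k
      using hpos[of k] by (simp add: divide_right_mono mult.commute)
    then have "(\<Sum>k\<in>UNIV. l $ k * (\<bar>(Q *v x) $ k\<bar> / h $ k + (\<Sum>j\<in>UNIV. l $ j * (\<bar>(Q *v x) $ j\<bar> / h $ j))))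
       \<le> (\<Sum>k\<in>UNIV. l $ k * (K0 / h $ k * norm x + (\<Sum>j\<in>UNIV. l $ j * (K0 / h $ j * norm x))))"
      using pos by (intro sum_mono mult_left_mono add_mono) (auto simp: less_imp_le)
    also have "\<dots> = K * norm x"
      by (simp add: K_def sum_distrib_right distrib_right mult.assoc)
    finally show ?thesis .
  qed
  \<comment> \<open>The midpoint of \<kappa> and 1: the linear part takes \<kappa>, and (1 -
    \<kappa>)/2 is left for the remainder.\<close>
  define \<kappa>' where "\<kappa>' = (1 + \<kappa>) / 2"
  have \<kappa>': "0 \<le> \<kappa>'" "\<kappa>' < 1" "\<kappa>' = \<kappa> + (1 - \<kappa>) / 2" using N(6,7) by (auto simp: \<kappa>'_def field_simps)
  \<comment> \<open>The remainder over \<open>d\<close> messages has Euclidean norm at most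
    (\<beta>^(4d+5) - 1) K d B, and \<open>c\<close> converts it to \<open>N\<close>.\<close>
  obtain \<beta> where \<beta>: "1 < \<beta>" "(\<beta> ^ (4 * d + 5) - 1) * (c * K * d) \<le> (1 - \<kappa>) / 2"
    using ex_factor_close_to_one[of "(1 - \<kappa>) / 2"] N(7) by auto
  have "\<forall>\<^sub>F x in nhds l. \<forall>k. (Q *v x) $ k < \<beta> * h $ k \<and> h $ k < \<beta> * (Q *v x) $ k"
  proof (rule eventually_all_finite)
    fix k
    have lm: "((\<lambda>x. (Q *v x) $ k) \<longlongrightarrow> h $ k) (nhds l)"
      unfolding matrix_vector_mult_def h_def by (auto intro!: tendsto_intros filterlim_ident)
    have "h $ k < \<beta> * h $ k" using \<beta> hpos[of k] by simp
    then have "\<forall>\<^sub>F x in nhds l. (Q *v x) $ k < \<beta> * h $ k"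
      by (rule order_tendstoD(2)[OF lm])
    moreover have "\<forall>\<^sub>F x in nhds l. h $ k < \<beta> * (Q *v x) $ k"
      using \<open>h $ k < \<beta> * h $ k\<close> by (intro order_tendstoD(1)[OF tendsto_mult_left[OF lm]])
    ultimately show "\<forall>\<^sub>F x in nhds l. (Q *v x) $ k < \<beta> * h $ k \<and> h $ k < \<beta> * (Q *v x) $ k"
      by (rule eventually_conj)
  qed
  then obtain \<rho>0 where \<rho>0: "0 < \<rho>0"
    "\<And>x k. dist x l < \<rho>0 \<Longrightarrow> (Q *v x) $ k < \<beta> * h $ k \<and> h $ k < \<beta> * (Q *v x) $ k"
    unfolding eventually_nhds_metric by blast
  \<comment> \<open>Halving passes from the open ball of radius \<open>\<rho>0\<close> to a closed
    ball, which is what invariance speaks about.\<close>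
  define \<rho> where "\<rho> = \<rho>0 / 2"
  have \<rho>: "0 < \<rho>" using \<rho>0 by (simp add: \<rho>_def)
  have near: "0 < (Q *v x) $ k \<and> within_factor \<beta> ((Q *v x) $ k) (h $ k)" if "N (x - l) \<le> \<rho>" for x k
  proof -
    have "dist x l < \<rho>0" using N(3)[of "x - l"] that \<rho> by (simp add: dist_norm \<rho>_def)
    then have *: "(Q *v x) $ k < \<beta> * h $ k" "h $ k < \<beta> * (Q *v x) $ k" using \<rho>0 by auto
    have "0 < \<beta> * (Q *v x) $ k" using * hpos[of k] by linarith
    then show ?thesis using * \<beta> by (auto simp: within_factor_def zero_less_mult_iff)
  qed
  \<comment> \<open>A field within factor \<gamma> of 1 displaces the image of \<open>l\<close> by
    at most c (\<gamma>^2 - 1) in \<open>N\<close>. Together with the contracted part \<kappa>'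
    \<rho> this has to stay within \<rho>.\<close>
  obtain \<gamma>0 where \<gamma>0: "1 < \<gamma>0" "(\<gamma>0 ^ 2 - 1) * c \<le> (1 - \<kappa>') * \<rho>"
    using ex_factor_close_to_one[of "(1 - \<kappa>') * \<rho>"] \<rho> \<kappa>' by auto
  \<comment> \<open>The cap \<beta> makes the fields admissible in
    \<open>message_mean_value\<close>.\<close>
  define \<gamma> where "\<gamma> = min \<beta> \<gamma>0"
  have \<gamma>: "1 < \<gamma>" "\<gamma> \<le> \<beta>" "\<gamma> \<le> \<gamma>0" using \<beta> \<gamma>0 by (auto simp: \<gamma>_def)
  have contr: "N (message Q g C m - message Q g C m') \<le> \<kappa>' * B"
    if C: "finite C" "card C = d" and g: "\<And>k. 0 < g $ k \<and> within_factor \<gamma> (g $ k) 1"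
      and m: "\<And>c. c \<in> C \<Longrightarrow> N (m c - l) \<le> \<rho>" "\<And>c. c \<in> C \<Longrightarrow> N (m' c - l) \<le> \<rho>"
      and B: "\<And>c. c \<in> C \<Longrightarrow> N (m c - m' c) \<le> B" "0 \<le> B"
    for g and C :: "'c set" and m m' B
  proof -
    define M where "M c = message_deriv l h (Q *v (m c - m' c))" for c
    define R where "R = message Q g C m - message Q g C m' - (\<Sum>c\<in>C. M c)"
    let ?e = "\<beta> ^ (4 * d + 5) - 1"
    have e: "0 \<le> ?e" using \<beta> by simp
    have "\<bar>R $ k\<bar> \<le> (\<Sum>c\<in>C. ?e * (l $ k * (\<bar>(Q *v (m c - m' c)) $ k\<bar> / h $ k +
       (\<Sum>j\<in>UNIV. l $ j * (\<bar>(Q *v (m c - m' c)) $ j\<bar> / h $ j)))))" for k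
      unfolding R_def M_def h_def C(2)[symmetric] vector_minus_component sum_component
    proof (rule message_mean_value[OF C(1)])
      show "0 < g $ k" "within_factor \<beta> (g $ k) 1" for k
        using g[of k] \<gamma>(2) by (auto intro: within_factor_mono simp: less_imp_le)
      show "message Q 1 C (\<lambda>_. l) = l" by (rule message_fixed_point[OF Q l C(2)])
    qed (use \<beta> hpos pos near[OF m(1)] near[OF m(2)] in \<open>auto simp: h_def\<close>)
    then have "norm R \<le> (\<Sum>k\<in>UNIV. \<Sum>c\<in>C. ?e * (l $ k * (\<bar>(Q *v (m c - m' c)) $ k\<bar> / h $ k +
       (\<Sum>j\<in>UNIV. l $ j * (\<bar>(Q *v (m c - m' c)) $ j\<bar> / h $ j)))))"
      by (intro order_trans[OF norm_le_l1_cart] sum_mono)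
    also have "\<dots> = (\<Sum>c\<in>C. ?e * (\<Sum>k\<in>UNIV. l $ k * (\<bar>(Q *v (m c - m' c)) $ k\<bar> / h $ k +
       (\<Sum>j\<in>UNIV. l $ j * (\<bar>(Q *v (m c - m' c)) $ j\<bar> / h $ j)))))"
      by (subst sum.swap) (simp add: sum_distrib_left)
    also have "\<dots> \<le> (\<Sum>c\<in>C. ?e * (K * B))"
    proof (rule sum_mono)
      fix c assume c: "c \<in> C"
      have "0 \<le> K" unfolding K_def using pos hpos K0
        by (intro sum_nonneg mult_nonneg_nonneg add_nonneg_nonneg divide_nonneg_nonneg)
          (auto simp: less_imp_le)
      then have "K * norm (m c - m' c) \<le> K * B"
        using order_trans[OF N(3) B(1)[OF c]] by (intro mult_left_mono)
      then show "?e * (\<Sum>k\<in>UNIV. l $ k * (\<bar>(Q *v (m c - m' c)) $ k\<bar> / h $ k +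
          (\<Sum>j\<in>UNIV. l $ j * (\<bar>(Q *v (m c - m' c)) $ j\<bar> / h $ j)))) \<le> ?e * (K * B)"
        by (intro mult_left_mono[OF order_trans[OF Kb] e])
    qed
    finally have R: "norm R \<le> ?e * (K * d) * B" using C by (simp add: mult_ac)
    have "N R \<le> c * norm R" by (rule N(4))
    also have "\<dots> \<le> c * (?e * (K * d) * B)" using R N(8) by (intro mult_left_mono) auto
    also have "\<dots> = ?e * (c * K * d) * B" by (simp add: mult_ac)
    also have "\<dots> \<le> (1 - \<kappa>) / 2 * B" using \<beta>(2) B(2) by (rule mult_right_mono)
    finally have NR: "N R \<le> (1 - \<kappa>) / 2 * B" .
    have "N (\<Sum>c\<in>C. M c) \<le> \<kappa> * B"
    proof (cases "d = 0")
      case True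
      then show ?thesis using C B N(6) by (simp add: N0)
    next
      case False
      \<comment> \<open>One message accounts for the d-th part of the differential; adding
        \<open>d\<close> of them restores \<kappa> B.\<close>
      have "N (M c) \<le> \<kappa> * B / d" if "c \<in> C" for c
      proof -
        have "A (m c - m' c) = real d *\<^sub>R M c"
          unfolding A_def M_def h_def by (rule boundary_map_derivative[OF Q l])
        then have "real d * N (M c) \<le> \<kappa> * N (m c - m' c)" using N(2,5) by (metis abs_of_nat)
        also have "\<dots> \<le> \<kappa> * B" using B(1)[OF that] N(6) by (rule mult_left_mono)
        finally show ?thesis using False by (simp add: field_simps)
      qed
      then have "(\<Sum>c\<in>C. N (M c)) \<le> (\<Sum>c\<in>C. \<kappa> * B / d)" by (rule sum_mono)
      then show ?thesis using Nsum[of M C] C False by simp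
    qed
    moreover have "N (message Q g C m - message Q g C m') \<le> N (\<Sum>c\<in>C. M c) + N R"
      using N(1)[of "\<Sum>c\<in>C. M c" R] by (simp add: R_def)
    ultimately show ?thesis using NR by (simp add: \<kappa>'(3) distrib_right)
  qed
  have inv: "N (message Q g C m - l) \<le> \<rho>"
    if C: "finite C" "card C = d" and g: "\<And>k. 0 < g $ k \<and> within_factor \<gamma> (g $ k) 1"
      and m: "\<And>c. c \<in> C \<Longrightarrow> N (m c - l) \<le> \<rho>"
    for g and C :: "'c set" and m
  proof -
    \<comment> \<open>The triangle inequality goes through the update with the given field and all
      incoming messages equal to \<open>l\<close>.\<close>
    have 1: "N (message Q g C m - message Q g C (\<lambda>_. l)) \<le> \<kappa>' * \<rho>"
      using C g m \<rho> N0 by (intro contr) auto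
    have hl: "\<And>k. 0 < (Q *v l) $ k" using hpos by (simp add: h_def)
    have w: "within_factor ((\<gamma> * 1 ^ card C)\<^sup>2) (message Q g C (\<lambda>_. l) $ k) (message Q 1 C (\<lambda>_. l) $ k)" for k
      using g hl \<gamma> by (intro message_within_factor) (auto intro!: within_factor_refl simp: less_imp_le)
    have "\<bar>(message Q g C (\<lambda>_. l) - l) $ k\<bar> \<le> (\<gamma>\<^sup>2 - 1) * l $ k" for k
      using within_factor_abs_diff[OF w[of k]] \<gamma>(1) message_pos[of g C Q "\<lambda>_. l" k] g hl pos[of k]
      unfolding message_fixed_point[OF Q l C(2)] by (simp add: less_imp_le)
    then have "norm (message Q g C (\<lambda>_. l) - l) \<le> (\<Sum>k\<in>UNIV. (\<gamma>\<^sup>2 - 1) * l $ k)"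
      by (intro order_trans[OF norm_le_l1_cart] sum_mono)
    then have "norm (message Q g C (\<lambda>_. l) - l) \<le> \<gamma>\<^sup>2 - 1"
      by (simp add: sum_distrib_left[symmetric] l1)
    also have "\<dots> \<le> \<gamma>0\<^sup>2 - 1" using \<gamma> by (simp add: power_mono)
    finally have "c * norm (message Q g C (\<lambda>_. l) - l) \<le> c * (\<gamma>0\<^sup>2 - 1)"
      using N(8) by (intro mult_left_mono) auto
    then have "N (message Q g C (\<lambda>_. l) - l) \<le> (1 - \<kappa>') * \<rho>"
      using N(4)[of "message Q g C (\<lambda>_. l) - l"] \<gamma>0(2) by (simp add: mult.commute)
    then show ?thesis
      using 1 N(1)[of "message Q g C m - message Q g C (\<lambda>_. l)" "message Q g C (\<lambda>_. l) - l"]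
      by (simp add: algebra_simps)
  qed
  have "contracts_near Q l N \<kappa>' \<rho> \<gamma> C" if "finite C" "card C = d" for C :: "'c set"
    unfolding contracts_near_def using that by (intro allI impI conjI contr inv) auto
  then show thesis
    by (intro that[of N \<kappa>' \<rho> \<gamma>, OF N(1) Nm N(3) N0 \<kappa>'(1) \<kappa>'(2) \<rho> \<gamma>(1)]) blast
qed

section \<open>Cayley trees seen from a root\<close>

text \<open>The root will be the site whose conditional law is studied; the locale is interpreted
  anew for every site.\<close>

locale rooted_cayley_tree =
  fixes E :: "'v set set" and d :: nat and root :: 'v
  assumes tree: "cayley_tree d E"
begin

lemma adjacent_sym: "adjacent E x y \<Longrightarrow> adjacent E y x"
  by (simp add: adjacent_def insert_commute)

lemma not_adjacent_refl: "\<not> adjacent E x x"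
  using tree by (auto simp: cayley_tree_def is_tree_def simple_graph_def adjacent_def)

lemma no_cycle: "\<not> is_cycle E p"
  using tree by (auto simp: cayley_tree_def is_tree_def)

lemma card_neighbours: "card {y. adjacent E x y} = d + 1"
  using tree by (auto simp: cayley_tree_def)

lemma finite_neighbours: "finite {y. adjacent E x y}"
  using card_neighbours[of x] by (metis Suc_eq_plus1 card.infinite nat.distinct(1))

primrec tree_ball :: "nat \<Rightarrow> 'v set" where
  "tree_ball 0 = {root}"
| "tree_ball (Suc n) = tree_ball n \<union> (\<Union>y\<in>tree_ball n. {z. adjacent E y z})"

definition depth :: "'v \<Rightarrow> nat" where
  "depth y = (LEAST n. y \<in> tree_ball n)"

lemma finite_tree_ball: "finite (tree_ball n)"
  by (induction n) (auto simp: finite_neighbours)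

lemma tree_ball_mono: "m \<le> n \<Longrightarrow> tree_ball m \<subseteq> tree_ball n"
  by (rule lift_Suc_mono_le[of tree_ball]) auto

lemma ex_tree_ball: "\<exists>n. y \<in> tree_ball n"
proof -
  obtain p where p: "p \<noteq> []" "hd p = root" "last p = y" "successively (adjacent E) p"
    using tree unfolding cayley_tree_def is_tree_def connected_in_def by blast
  have "last p \<in> tree_ball (n + length p)"
    if "p \<noteq> []" "hd p \<in> tree_ball n" "successively (adjacent E) p" for p n
    using that
  proof (induction p arbitrary: n rule: list_nonempty_induct)
    case (single x)
    then show ?case using tree_ball_mono[of n "n + 1"] by auto
  next
    case (cons x xs)
    then have "last xs \<in> tree_ball (Suc n + length xs)"
      by (intro cons.IH) (auto simp: successively_Cons)
    then show ?case using cons.hyps by simp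
  qed
  from this[of p 0] p show ?thesis by auto
qed

lemma mem_tree_ball_iff: "y \<in> tree_ball n \<longleftrightarrow> depth y \<le> n"
proof
  show "y \<in> tree_ball n \<Longrightarrow> depth y \<le> n"
    unfolding depth_def by (rule Least_le)
  have "y \<in> tree_ball (depth y)"
    unfolding depth_def using ex_tree_ball by (rule LeastI_ex)
  then show "depth y \<le> n \<Longrightarrow> y \<in> tree_ball n"
    using tree_ball_mono by blast
qed

lemma depth_eq_0_iff: "depth y = 0 \<longleftrightarrow> y = root"
  using mem_tree_ball_iff[of y 0] by simp

lemma depth_adjacent_le: "adjacent E y z \<Longrightarrow> depth z \<le> Suc (depth y)"
  using mem_tree_ball_iff[of y "depth y"] mem_tree_ball_iff[of z "Suc (depth y)"]
  unfolding tree_ball.simps by blast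

lemma ex_lower_neighbour:
  assumes "depth y = Suc n"
  shows "\<exists>z. adjacent E y z \<and> depth z = n"
proof -
  have "y \<in> tree_ball (Suc n)" "y \<notin> tree_ball n" using assms by (simp_all add: mem_tree_ball_iff del: tree_ball.simps)
  then obtain z where z: "z \<in> tree_ball n" "adjacent E z y"
    unfolding tree_ball.simps by blast
  then have "depth z = n" using depth_adjacent_le[of z y] assms by (simp add: mem_tree_ball_iff)
  then show ?thesis using adjacent_sym z by blast
qed

text \<open>Two vertices at the same level are joined by descending to a common ancestor; an edge
  within a level, or a second edge to the level below, would close such a path to a cycle.\<close>

lemma ex_path_below_level:
  assumes "depth u = n" "depth v = n" "u \<noteq> v"
  shows "\<exists>p. distinct p \<and> successively (adjacent E) p \<and> length p \<ge> 3 \<and> hd p = u \<and> last p = v \<and>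
    (\<forall>x\<in>set p. x = u \<or> x = v \<or> depth x < n)"
  using assms
proof (induction n arbitrary: u v)
  case 0
  then show ?case by (simp add: depth_eq_0_iff)
next
  case (Suc n)
  obtain u' where u': "adjacent E u u'" "depth u' = n" using ex_lower_neighbour Suc.prems(1) by blast
  obtain v' where v': "adjacent E v v'" "depth v' = n" using ex_lower_neighbour Suc.prems(2) by blast
  show ?case
  proof (cases "u' = v'")
    case True
    then show ?thesis using u' v' Suc.prems adjacent_sym[OF v'(1)]
      by (intro exI[of _ "[u, u', v]"]) auto
  next
    case False
    then obtain p where p: "distinct p" "successively (adjacent E) p" "length p \<ge> 3" "hd p = u'"
      "last p = v'" "\<forall>x\<in>set p. x = u' \<or> x = v' \<or> depth x < n"
      using Suc.IH[OF u'(2) v'(2)] by blast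
    then have "\<forall>x\<in>set p. depth x < Suc n" using u' v' by auto
    moreover have "p \<noteq> []" using p by auto
    ultimately show ?thesis using p u' v' Suc.prems adjacent_sym[OF v'(1)]
      by (intro exI[of _ "u # p @ [v]"]) (auto simp: successively_append_iff successively_Cons)
  qed
qed

lemma depth_adjacent_neq:
  assumes "adjacent E u v"
  shows "depth u \<noteq> depth v"
proof
  assume eq: "depth u = depth v"
  have "u \<noteq> v" using assms not_adjacent_refl by auto
  then obtain p where "distinct p" "successively (adjacent E) p" "length p \<ge> 3" "hd p = u" "last p = v"
    using ex_path_below_level[OF refl eq[symmetric]] by blast
  then have "is_cycle E p" using adjacent_sym[OF assms] by (simp add: is_cycle_def)
  then show False using no_cycle by blast
qed

lemma lower_neighbour_unique:
  assumes "adjacent E y u" "adjacent E y v" "Suc (depth u) = depth y" "Suc (depth v) = depth y"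
  shows "u = v"
proof (rule ccontr)
  assume "u \<noteq> v"
  moreover have "depth v = depth u" using assms by simp
  ultimately obtain p where p: "distinct p" "successively (adjacent E) p" "length p \<ge> 3" "hd p = u"
    "last p = v" "\<forall>x\<in>set p. x = u \<or> x = v \<or> depth x < depth u"
    using ex_path_below_level[OF refl] by blast
  have "y \<notin> set p" using p(6) assms by auto
  moreover have "p \<noteq> []" using p by auto
  ultimately have "is_cycle E (y # p)"
    using p assms adjacent_sym[OF assms(2)] by (auto simp: is_cycle_def successively_Cons)
  then show False using no_cycle by blast
qed

text \<open>At the root no such neighbour exists and the choice is arbitrary, hence the recurring
  exclusion of \<open>root\<close>.\<close>

definition parent :: "'v \<Rightarrow> 'v" where
  "parent y = (SOME z. adjacent E y z \<and> Suc (depth z) = depth y)"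

definition children :: "'v \<Rightarrow> 'v set" where
  "children y = {z. adjacent E y z \<and> depth z = Suc (depth y)}"

lemma
  assumes "y \<noteq> root"
  shows adjacent_parent: "adjacent E y (parent y)"
    and depth_parent: "Suc (depth (parent y)) = depth y"
proof -
  obtain n where "depth y = Suc n" using assms depth_eq_0_iff[of y] by (cases "depth y") auto
  then have "\<exists>z. adjacent E y z \<and> Suc (depth z) = depth y" using ex_lower_neighbour[of y n] by auto
  from someI_ex[OF this] show "adjacent E y (parent y)" "Suc (depth (parent y)) = depth y"
    unfolding parent_def by auto
qed

lemma parent_eqI: "adjacent E y z \<Longrightarrow> depth y = Suc (depth z) \<Longrightarrow> parent y = z"
proof -
  assume *: "adjacent E y z" "depth y = Suc (depth z)"
  then have "y \<noteq> root" by (auto simp: depth_eq_0_iff[symmetric])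
  then show "parent y = z"
    using * by (intro lower_neighbour_unique[of y] adjacent_parent depth_parent) auto
qed

text \<open>Sets of children are the fibres of \<open>parent\<close> off the root, hence disjoint;
  products over a sphere can be grouped accordingly.\<close>

lemma mem_children_iff: "z \<in> children y \<longleftrightarrow> z \<noteq> root \<and> parent z = y"
  using parent_eqI[of z y] adjacent_sym adjacent_parent[of z] depth_parent[of z] depth_eq_0_iff[of z]
  by (auto simp: children_def)

lemma children_neq_root: "z \<in> children y \<Longrightarrow> z \<noteq> root"
  by (simp add: mem_children_iff)

lemma depth_children: "z \<in> children y \<Longrightarrow> depth z = Suc (depth y)"
  by (simp add: children_def)

lemma finite_children: "finite (children y)"
  unfolding children_def by (rule finite_subset[OF _ finite_neighbours[of y]]) auto

lemma neighbours_eq: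
  "{z. adjacent E y z} = (if y = root then children y else insert (parent y) (children y))"
proof -
  have "z \<in> children y \<or> (y \<noteq> root \<and> z = parent y)" if "adjacent E y z" for z
  proof -
    have "depth z = Suc (depth y) \<or> depth y = Suc (depth z)"
      using depth_adjacent_le[OF that] depth_adjacent_le[OF adjacent_sym[OF that]]
        depth_adjacent_neq[OF that] by linarith
    then show ?thesis using that parent_eqI[of y z] depth_eq_0_iff[of y] by (auto simp: children_def)
  qed
  then show ?thesis using adjacent_parent[of y] by (auto simp: children_def)
qed

lemma card_children: "y \<noteq> root \<Longrightarrow> card (children y) = d"
proof -
  assume y: "y \<noteq> root"
  have "parent y \<notin> children y" using depth_parent[OF y] by (auto simp: children_def)
  then show ?thesis using card_neighbours[of y] y by (simp add: neighbours_eq finite_children)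
qed

section \<open>Spheres, boundaries and edges of balls\<close>

definition sphere :: "nat \<Rightarrow> 'v set" where
  "sphere n = {y. depth y = n}"

lemma finite_sphere: "finite (sphere n)"
  by (rule finite_subset[OF _ finite_tree_ball[of n]]) (auto simp: sphere_def mem_tree_ball_iff)

lemma tree_ball_Suc_eq: "tree_ball (Suc n) = tree_ball n \<union> sphere (Suc n)"
  by (auto simp: mem_tree_ball_iff sphere_def simp del: tree_ball.simps)

lemma tree_ball_Int_sphere: "tree_ball n \<inter> sphere (Suc n) = {}"
  by (auto simp: mem_tree_ball_iff sphere_def)

lemma sphere_Suc: "sphere (Suc n) = (\<Union>y\<in>sphere n. children y)"
proof -
  have "\<exists>z. depth z = n \<and> y \<in> children z" if "depth y = Suc n" for y
  proof -
    have "y \<noteq> root" using that depth_eq_0_iff[of y] by auto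
    then show ?thesis using depth_parent[of y] that by (auto simp: mem_children_iff)
  qed
  then show ?thesis by (auto simp: sphere_def depth_children)
qed

lemma outer_boundary_tree_ball: "outer_boundary E (tree_ball n) = sphere (Suc n)"
proof -
  have "\<exists>x\<in>tree_ball n. adjacent E x y" if "depth y = Suc n" for y
    using ex_lower_neighbour[OF that] adjacent_sym mem_tree_ball_iff by (metis order_refl)
  moreover have "depth y = Suc n" if "y \<notin> tree_ball n" "x \<in> tree_ball n" "adjacent E x y" for x y
    using that depth_adjacent_le[of x y] by (auto simp: mem_tree_ball_iff)
  ultimately show ?thesis by (auto simp: outer_boundary_def sphere_def mem_tree_ball_iff)
qed

text \<open>An edge is labelled by its endpoint farther from the root, so that products over edges
  become products over vertices.\<close>

lemma edges_meeting_tree_ball: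
  "{e \<in> E. e \<inter> tree_ball n \<noteq> {}} = (\<lambda>y. {y, parent y}) ` (tree_ball (Suc n) - {root})"
proof (intro equalityI subsetI)
  fix e assume "e \<in> {e \<in> E. e \<inter> tree_ball n \<noteq> {}}"
  then have e: "e \<in> E" "e \<inter> tree_ball n \<noteq> {}" by auto
  then have "card e = 2" using tree by (auto simp: cayley_tree_def is_tree_def simple_graph_def)
  then obtain a b where ab: "e = {a, b}" by (auto simp: card_2_iff)
  then have "adjacent E a b" "adjacent E b a" using e by (auto simp: adjacent_def insert_commute)
  then have "(a \<noteq> root \<and> b = parent a) \<or> (b \<noteq> root \<and> a = parent b)"
    using neighbours_eq[of a] mem_children_iff by (metis insertE mem_Collect_eq)
  then obtain y where y: "y \<noteq> root" "e = {y, parent y}" using ab by (auto simp: insert_commute)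
  then have "depth y \<le> Suc n" using e(2) depth_parent[OF y(1)] by (auto simp: mem_tree_ball_iff)
  then show "e \<in> (\<lambda>y. {y, parent y}) ` (tree_ball (Suc n) - {root})"
    using y by (auto simp: mem_tree_ball_iff simp del: tree_ball.simps)
next
  fix e assume "e \<in> (\<lambda>y. {y, parent y}) ` (tree_ball (Suc n) - {root})"
  then obtain y where e: "e = {y, parent y}" and "y \<in> tree_ball (Suc n) - {root}" by (rule imageE)
  then have y: "depth y \<le> Suc n" "y \<noteq> root"
    by (simp_all add: mem_tree_ball_iff del: tree_ball.simps)
  then have "parent y \<in> tree_ball n" using depth_parent[OF y(2)] by (auto simp: mem_tree_ball_iff)
  then show "e \<in> {e \<in> E. e \<inter> tree_ball n \<noteq> {}}"
    using adjacent_parent[OF y(2)] by (auto simp: e adjacent_def)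
qed

lemma inj_on_parent_edge: "inj_on (\<lambda>y. {y, parent y}) (- {root})"
proof (rule inj_onI)
  fix y z assume "y \<in> - {root}" "z \<in> - {root}" and eq: "{y, parent y} = {z, parent z}"
  then show "y = z"
    using depth_parent[of y] depth_parent[of z] by (auto simp: doubleton_eq_iff)
qed

lemma connected_tree_ball: "connected_in E (tree_ball n)"
  unfolding connected_in_def
proof (intro ballI)
  fix x y assume x: "x \<in> tree_ball n" and y: "y \<in> tree_ball n"
  let ?P = "\<lambda>x y p. p \<noteq> [] \<and> set p \<subseteq> tree_ball n \<and> hd p = x \<and> last p = y \<and> successively (adjacent E) p"
  have base: "\<exists>p. ?P root y p"
    using y
  proof (induction "depth y" arbitrary: y)
    case 0
    then have "y = root" by (simp add: depth_eq_0_iff[symmetric])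
    then show ?case using 0 by (intro exI[of _ "[root]"]) auto
  next
    case (Suc m)
    then have "y \<noteq> root" by (auto simp: depth_eq_0_iff[symmetric])
    note par = adjacent_parent[OF this] depth_parent[OF this]
    then have "parent y \<in> tree_ball n" "m = depth (parent y)" using Suc by (auto simp: mem_tree_ball_iff)
    then obtain p where "?P root (parent y) p" using Suc.hyps(1) by blast
    then show ?case using adjacent_sym[OF par(1)] Suc.prems
      by (intro exI[of _ "p @ [y]"]) (auto simp: successively_append_iff)
  qed
  show "\<exists>p. ?P x y p"
    using x
  proof (induction "depth x" arbitrary: x)
    case 0
    then have "x = root" by (simp add: depth_eq_0_iff[symmetric])
    then show ?case using base by simp
  next
    case (Suc m)
    then have "x \<noteq> root" by (auto simp: depth_eq_0_iff[symmetric])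
    note par = adjacent_parent[OF this] depth_parent[OF this]
    then have "parent x \<in> tree_ball n" "m = depth (parent x)" using Suc by (auto simp: mem_tree_ball_iff)
    then obtain p where "?P (parent x) y p" using Suc.hyps(1) by blast
    then show ?case using par(1) Suc.prems
      by (intro exI[of _ "x # p"]) (auto simp: successively_Cons)
  qed
qed

lemma finite_subset_tree_ball:
  fixes D :: "'v set"
  assumes "finite D"
  shows "\<exists>n. D \<subseteq> tree_ball n"
proof -
  have "D \<subseteq> tree_ball (Max (insert 0 (depth ` D)))"
    using assms by (auto simp: mem_tree_ball_iff intro!: Max_ge)
  then show ?thesis ..
qed

section \<open>Summing out the spins sphere by sphere\<close>

definition tree_sum :: "real^'s^'s \<Rightarrow> nat \<Rightarrow> ('v \<Rightarrow> real^'s) \<Rightarrow> real" where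
  "tree_sum Q n u = (\<Sum>\<omega>\<in>tree_ball n \<rightarrow>\<^sub>E UNIV.
     (\<Prod>y\<in>tree_ball n. u y $ \<omega> y) * (\<Prod>y\<in>tree_ball n - {root}. Q $ \<omega> (parent y) $ \<omega> y))"

lemma sum_PiE_Un:
  fixes f :: "('v \<Rightarrow> 's::finite) \<Rightarrow> real"
  assumes "finite A" "finite B" "A \<inter> B = {}"
  shows "(\<Sum>\<omega>\<in>A \<union> B \<rightarrow>\<^sub>E UNIV. f \<omega>) = (\<Sum>\<alpha>\<in>A \<rightarrow>\<^sub>E UNIV. \<Sum>\<beta>\<in>B \<rightarrow>\<^sub>E UNIV. f (merge A B (\<alpha>, \<beta>)))"
  unfolding sum.cartesian_product
proof (rule sum.reindex_bij_witness[where i = "merge A B" and j = "\<lambda>\<omega>. (restrict \<omega> A, restrict \<omega> B)"])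
  fix \<omega> :: "'v \<Rightarrow> 's" assume "\<omega> \<in> A \<union> B \<rightarrow>\<^sub>E UNIV"
  then show mr: "merge A B (restrict \<omega> A, restrict \<omega> B) = \<omega>"
    by (auto simp: merge_def PiE_iff extensional_def fun_eq_iff)
  show "(case (restrict \<omega> A, restrict \<omega> B) of (\<alpha>, \<beta>) \<Rightarrow> f (merge A B (\<alpha>, \<beta>))) = f \<omega>"
    by (simp only: prod.case mr)
qed (use assms in \<open>auto simp: merge_def PiE_iff extensional_def fun_eq_iff\<close>)

text \<open>Given the spins of the inner ball, those on the outer sphere interact only with their
  parents, so the inner sum factorises; grouping by parents yields message weights. Allowing an
  arbitrary vector \<open>u y\<close> at each site keeps the result of the form
  \<open>tree_sum\<close>.\<close>

lemma tree_sum_Suc: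
  fixes Q :: "real^'s^'s"
  shows "tree_sum Q (Suc n) u = tree_sum Q n
     (\<lambda>y. if depth y = n then message_weight Q (u y) (children y) u else u y)"
proof -
  let ?A = "tree_ball n" and ?B = "sphere (Suc n)"
  define m :: "('v \<Rightarrow> 's) \<times> ('v \<Rightarrow> 's) \<Rightarrow> 'v \<Rightarrow> 's" where "m = merge ?A ?B"
  have mA: "m (\<alpha>, \<beta>) y = \<alpha> y" if "y \<in> ?A" for \<alpha> \<beta> :: "'v \<Rightarrow> 's" and y
    using that by (simp add: m_def merge_def)
  have mB: "m (\<alpha>, \<beta>) y = \<beta> y" if "y \<in> ?B" for \<alpha> \<beta> :: "'v \<Rightarrow> 's" and y
    using that tree_ball_Int_sphere[of n] by (auto simp: m_def merge_def)
  have root: "root \<in> ?A" "root \<notin> ?B"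
    using depth_eq_0_iff[of root] by (auto simp: mem_tree_ball_iff sphere_def)
  have par: "parent y \<in> ?A" if "y \<in> ?A \<union> ?B" "y \<noteq> root" for y
    using that depth_parent[of y] by (auto simp: mem_tree_ball_iff sphere_def)
  then have parB: "parent y \<in> ?A" if "y \<in> ?B" for y
    using that root(2) by blast
  have diff: "?A \<union> ?B - {root} = (?A - {root}) \<union> ?B" using root by auto
  have dis: "(?A - {root}) \<inter> ?B = {}" using tree_ball_Int_sphere[of n] by auto
  have inner: "(\<Sum>\<beta>\<in>?B \<rightarrow>\<^sub>E UNIV. \<Prod>z\<in>?B. Q $ \<alpha> (parent z) $ \<beta> z * u z $ \<beta> z) =
      (\<Prod>y\<in>sphere n. \<Prod>z\<in>children y. (Q *v u z) $ \<alpha> y)" for \<alpha> :: "'v \<Rightarrow> 's"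
  proof -
    have "(\<Sum>\<beta>\<in>?B \<rightarrow>\<^sub>E UNIV. \<Prod>z\<in>?B. Q $ \<alpha> (parent z) $ \<beta> z * u z $ \<beta> z) =
        (\<Prod>z\<in>?B. \<Sum>k\<in>UNIV. Q $ \<alpha> (parent z) $ k * u z $ k)"
      by (rule prod_sum_PiE[symmetric]) (auto simp: finite_sphere)
    also have "\<dots> = (\<Prod>z\<in>?B. (Q *v u z) $ \<alpha> (parent z))"
      by (simp add: matrix_vector_mult_def)
    also have "\<dots> = (\<Prod>y\<in>sphere n. \<Prod>z\<in>children y. (Q *v u z) $ \<alpha> (parent z))"
      unfolding sphere_Suc
      by (rule prod.UNION_disjoint) (auto simp: finite_sphere finite_children mem_children_iff)
    also have "\<dots> = (\<Prod>y\<in>sphere n. \<Prod>z\<in>children y. (Q *v u z) $ \<alpha> y)"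
      by (intro prod.cong refl) (auto simp: mem_children_iff)
    finally show ?thesis .
  qed
  have "tree_sum Q (Suc n) u = (\<Sum>\<alpha>\<in>?A \<rightarrow>\<^sub>E UNIV. \<Sum>\<beta>\<in>?B \<rightarrow>\<^sub>E UNIV.
      (\<Prod>y\<in>?A \<union> ?B. u y $ m (\<alpha>, \<beta>) y) *
      (\<Prod>y\<in>?A \<union> ?B - {root}. Q $ m (\<alpha>, \<beta>) (parent y) $ m (\<alpha>, \<beta>) y))"
    unfolding tree_sum_def tree_ball_Suc_eq m_def
    by (rule sum_PiE_Un) (auto simp: finite_tree_ball finite_sphere tree_ball_Int_sphere)
  also have "\<dots> = (\<Sum>\<alpha>\<in>?A \<rightarrow>\<^sub>E UNIV. \<Sum>\<beta>\<in>?B \<rightarrow>\<^sub>E UNIV.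
      ((\<Prod>y\<in>?A. u y $ \<alpha> y) * (\<Prod>y\<in>?A - {root}. Q $ \<alpha> (parent y) $ \<alpha> y)) *
      (\<Prod>z\<in>?B. Q $ \<alpha> (parent z) $ \<beta> z * u z $ \<beta> z))"
  proof (intro sum.cong refl)
    fix \<alpha> \<beta> :: "'v \<Rightarrow> 's"
    have 1: "(\<Prod>y\<in>?A \<union> ?B. u y $ m (\<alpha>, \<beta>) y) = (\<Prod>y\<in>?A. u y $ \<alpha> y) * (\<Prod>z\<in>?B. u z $ \<beta> z)"
      by (subst prod.union_disjoint) (auto simp: finite_tree_ball finite_sphere tree_ball_Int_sphere mA mB)
    have 2: "(\<Prod>y\<in>?A \<union> ?B - {root}. Q $ m (\<alpha>, \<beta>) (parent y) $ m (\<alpha>, \<beta>) y) =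
        (\<Prod>y\<in>?A - {root}. Q $ \<alpha> (parent y) $ \<alpha> y) * (\<Prod>z\<in>?B. Q $ \<alpha> (parent z) $ \<beta> z)"
      unfolding diff using dis par parB
      by (subst prod.union_disjoint)
        (auto simp: finite_tree_ball finite_sphere mA mB intro!: arg_cong2[where f = "(*)"] prod.cong)
    show "(\<Prod>y\<in>?A \<union> ?B. u y $ m (\<alpha>, \<beta>) y) *
        (\<Prod>y\<in>?A \<union> ?B - {root}. Q $ m (\<alpha>, \<beta>) (parent y) $ m (\<alpha>, \<beta>) y) =
      ((\<Prod>y\<in>?A. u y $ \<alpha> y) * (\<Prod>y\<in>?A - {root}. Q $ \<alpha> (parent y) $ \<alpha> y)) *
      (\<Prod>z\<in>?B. Q $ \<alpha> (parent z) $ \<beta> z * u z $ \<beta> z)"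
      unfolding 1 2 by (simp add: prod.distrib)
  qed
  also have "\<dots> = (\<Sum>\<alpha>\<in>?A \<rightarrow>\<^sub>E UNIV.
      ((\<Prod>y\<in>?A. u y $ \<alpha> y) * (\<Prod>y\<in>?A - {root}. Q $ \<alpha> (parent y) $ \<alpha> y)) *
      (\<Prod>y\<in>sphere n. \<Prod>z\<in>children y. (Q *v u z) $ \<alpha> y))"
    by (simp only: sum_distrib_left[symmetric] inner)
  also have "\<dots> = tree_sum Q n (\<lambda>y. if depth y = n then message_weight Q (u y) (children y) u else u y)"
    unfolding tree_sum_def
  proof (intro sum.cong refl)
    fix \<alpha> :: "'v \<Rightarrow> 's"
    have "sphere n = {y \<in> ?A. depth y = n}" by (auto simp: sphere_def mem_tree_ball_iff)
    then have "(\<Prod>y\<in>sphere n. \<Prod>z\<in>children y. (Q *v u z) $ \<alpha> y) =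
        (\<Prod>y\<in>?A. if depth y = n then \<Prod>z\<in>children y. (Q *v u z) $ \<alpha> y else 1)"
      by (simp add: prod.inter_filter finite_tree_ball)
    then have "(\<Prod>y\<in>?A. u y $ \<alpha> y) * (\<Prod>y\<in>sphere n. \<Prod>z\<in>children y. (Q *v u z) $ \<alpha> y) =
        (\<Prod>y\<in>?A. (if depth y = n then message_weight Q (u y) (children y) u else u y) $ \<alpha> y)"
      by (simp add: prod.distrib[symmetric] message_weight_def cong: if_cong)
         (auto intro!: prod.cong)
    then show "((\<Prod>y\<in>?A. u y $ \<alpha> y) * (\<Prod>y\<in>?A - {root}. Q $ \<alpha> (parent y) $ \<alpha> y)) *
        (\<Prod>y\<in>sphere n. \<Prod>z\<in>children y. (Q *v u z) $ \<alpha> y) =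
      (\<Prod>y\<in>?A. (if depth y = n then message_weight Q (u y) (children y) u else u y) $ \<alpha> y) *
        (\<Prod>y\<in>?A - {root}. Q $ \<alpha> (parent y) $ \<alpha> y)"
      by (simp add: mult_ac)
  qed
  finally show ?thesis .
qed

text \<open>The recursion runs over the height \<open>h\<close>, the number of generations below
  \<open>y\<close> that are summed out. In a ball of radius n a vertex at depth k has height n -
  k.\<close>

primrec upward_weight :: "real^'s^'s \<Rightarrow> real^'s \<Rightarrow> ('v \<Rightarrow> real^'s) \<Rightarrow> nat \<Rightarrow> 'v \<Rightarrow> real^'s" where
  "upward_weight Q l g 0 y = l"
| "upward_weight Q l g (Suc h) y = message_weight Q (g y) (children y) (upward_weight Q l g h)"

lemma tree_sum_eq_upward_weight:
  fixes Q :: "real^'s^'s"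
  shows "tree_sum Q n (\<lambda>y. if depth y = n then l else g y) = (\<Sum>k\<in>UNIV. upward_weight Q l g n root $ k)"
proof -
  \<comment> \<open>Here \<open>j\<close> counts the generations already summed out; n + j does not
    change when a sphere is removed.\<close>
  have step: "tree_sum Q n (\<lambda>y. if depth y = n then upward_weight Q l g j y else g y) =
      (\<Sum>k\<in>UNIV. upward_weight Q l g (n + j) root $ k)" for j
  proof (induction n arbitrary: j)
    case 0
    have "tree_ball 0 \<rightarrow>\<^sub>E UNIV = (\<lambda>k. \<lambda>y\<in>{root}. k) ` (UNIV :: 's set)"
      by (auto simp: PiE_iff extensional_def fun_eq_iff image_iff restrict_def split: if_splits)
    moreover have "inj (\<lambda>k::'s. \<lambda>y\<in>{root}. k)"
      by (rule injI) (metis restrict_apply' singletonI)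
    ultimately show ?case
      by (simp add: tree_sum_def sum.reindex o_def depth_eq_0_iff)
  next
    case (Suc n)
    have "(\<lambda>y. if depth y = n
         then message_weight Q (if depth y = Suc n then upward_weight Q l g j y else g y) (children y)
                (\<lambda>y. if depth y = Suc n then upward_weight Q l g j y else g y)
         else if depth y = Suc n then upward_weight Q l g j y else g y) y =
       (if depth y = n then upward_weight Q l g (Suc j) y else g y)" if "depth y \<le> n" for y
      using that by (auto simp: depth_children intro!: message_weight_cong)
    then have "tree_sum Q (Suc n) (\<lambda>y. if depth y = Suc n then upward_weight Q l g j y else g y) =
        tree_sum Q n (\<lambda>y. if depth y = n then upward_weight Q l g (Suc j) y else g y)"
      unfolding tree_sum_Suc unfolding tree_sum_def
      by (intro sum.cong arg_cong2[where f = "(*)"] prod.cong refl) (simp add: mem_tree_ball_iff)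
    then show ?case using Suc.IH[of "Suc j"] by simp
  qed
  show ?thesis using step[of 0] unfolding upward_weight.simps by simp
qed

text \<open>Messages arriving at the root do not see the field at the root, so observing the root
  spin in addition leaves them unchanged.\<close>

lemma upward_weight_cong:
  assumes "\<And>z. z \<noteq> root \<Longrightarrow> g z = g' z" "y \<noteq> root"
  shows "upward_weight Q l g h y = upward_weight Q l g' h y"
  using assms(2)
proof (induction h arbitrary: y)
  case 0
  then show ?case by simp
next
  case (Suc h)
  have "upward_weight Q l g h z = upward_weight Q l g' h z" if "z \<in> children y" for z
    using Suc.IH that by (simp add: mem_children_iff)
  then show ?case using assms(1)[OF Suc.prems] by (auto intro!: message_weight_cong)
qed

lemma upward_weight_pos:
  fixes Q :: "real^'s^'s"
  assumes "\<And>i j. 0 < Q $ i $ j" "\<And>i. 0 < l $ i" "\<And>y i. 0 < g y $ i"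
  shows "0 < upward_weight Q l g h y $ i"
proof (induction h arbitrary: y i)
  case (Suc h)
  show ?case using assms Suc by (auto intro!: message_weight_pos matrix_vector_pos)
qed (simp add: assms)

lemma normalized_upward_weight_Suc:
  fixes Q :: "real^'s^'s"
  assumes "\<And>i j. 0 < Q $ i $ j" "\<And>i. 0 < l $ i" "\<And>y i. 0 < g y $ i"
  shows "normalized (upward_weight Q l g (Suc h) y) =
    message Q (g y) (children y) (\<lambda>z. normalized (upward_weight Q l g h z))"
  using message_normalized[of "children y" "upward_weight Q l g h" Q "g y"] upward_weight_pos[OF assms]
  by (simp add: message_def)

end

section \<open>Conditional laws of the time-evolved measure\<close>

lemma integral_local_eq_sum_cylinder:
  fixes \<nu> :: "('v \<Rightarrow> 's::finite) measure" and \<phi> :: "('v \<Rightarrow> 's) \<Rightarrow> real"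
  assumes \<nu>: "prob_space \<nu>" "sets \<nu> = sets config_space" and B: "finite B"
    and loc: "\<And>\<omega> \<omega>'. (\<forall>x\<in>B. \<omega> x = \<omega>' x) \<Longrightarrow> \<phi> \<omega> = \<phi> \<omega>'"
  shows "(\<integral>\<sigma>. \<phi> \<sigma> \<partial>\<nu>) = (\<Sum>\<eta>\<in>B \<rightarrow>\<^sub>E UNIV. \<phi> \<eta> * measure \<nu> (cylinder B \<eta>))"
proof -
  interpret prob_space \<nu> by fact
  have fin: "finite (B \<rightarrow>\<^sub>E (UNIV::'s set))" using B by (intro finite_PiE) auto
  have [measurable]: "cylinder B \<eta> \<in> sets \<nu>" for \<eta>
    using sets_cylinder[OF B] \<nu>(2) by simp
  have "\<phi> \<sigma> = (\<Sum>\<eta>\<in>B \<rightarrow>\<^sub>E UNIV. \<phi> \<eta> * indicator (cylinder B \<eta>) \<sigma>)" for \<sigma>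
  proof -
    have "(\<Sum>\<eta>\<in>B \<rightarrow>\<^sub>E UNIV. \<phi> \<eta> * indicator (cylinder B \<eta>) \<sigma>) =
        (\<Sum>\<eta>\<in>B \<rightarrow>\<^sub>E UNIV. if restrict \<sigma> B = \<eta> then \<phi> \<eta> else 0)"
      by (intro sum.cong refl) (auto simp: cylinder_def indicator_def PiE_iff extensional_def fun_eq_iff)
    also have "\<dots> = \<phi> (restrict \<sigma> B)" using fin by simp
    also have "\<dots> = \<phi> \<sigma>" by (rule loc) simp
    finally show ?thesis by simp
  qed
  then have "(\<integral>\<sigma>. \<phi> \<sigma> \<partial>\<nu>) = (\<integral>\<sigma>. (\<Sum>\<eta>\<in>B \<rightarrow>\<^sub>E UNIV. \<phi> \<eta> * indicator (cylinder B \<eta>) \<sigma>) \<partial>\<nu>)"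
    by (intro Bochner_Integration.integral_cong refl)
  also have "\<dots> = (\<Sum>\<eta>\<in>B \<rightarrow>\<^sub>E UNIV. \<phi> \<eta> * measure \<nu> (cylinder B \<eta>))"
    by (subst Bochner_Integration.integral_sum) (auto simp: emeasure_eq_measure)
  finally show ?thesis .
qed

lemma measure_time_evolved_cylinder:
  fixes \<mu> :: "('v \<Rightarrow> 's::finite) measure"
  assumes q: "CARD('s) \<ge> 2" and t: "0 \<le> t" and \<mu>: "prob_space \<mu>" "sets \<mu> = sets config_space"
    and A: "finite A"
  shows "measure (time_evolved \<mu> t) (cylinder A \<zeta>) = (\<integral>\<omega>. (\<Prod>x\<in>A. flip_prob t (\<omega> x) (\<zeta> x)) \<partial>\<mu>)"
proof -
  have sel: "(\<Sum>\<eta>\<in>A \<rightarrow>\<^sub>E UNIV. indicator (cylinder A \<zeta>) \<eta> * (\<Prod>x\<in>A. flip_prob t (\<omega> x) (\<eta> x))) =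
      (\<Prod>x\<in>A. flip_prob t (\<omega> x) (\<zeta> x))" for \<omega>
  proof -
    have "finite (A \<rightarrow>\<^sub>E (UNIV::'s set))" using A by (intro finite_PiE) auto
    moreover have "(\<Sum>\<eta>\<in>A \<rightarrow>\<^sub>E UNIV. indicator (cylinder A \<zeta>) \<eta> * (\<Prod>x\<in>A. flip_prob t (\<omega> x) (\<eta> x))) =
        (\<Sum>\<eta>\<in>A \<rightarrow>\<^sub>E UNIV. if restrict \<zeta> A = \<eta> then \<Prod>x\<in>A. flip_prob t (\<omega> x) (\<eta> x) else 0)"
    proof (intro sum.cong refl)
      fix \<eta> :: "'v \<Rightarrow> 's" assume "\<eta> \<in> A \<rightarrow>\<^sub>E UNIV"
      then have "\<eta> \<in> cylinder A \<zeta> \<longleftrightarrow> restrict \<zeta> A = \<eta>"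
        by (auto simp: cylinder_def PiE_iff extensional_def fun_eq_iff restrict_def)
      then show "indicator (cylinder A \<zeta>) \<eta> * (\<Prod>x\<in>A. flip_prob t (\<omega> x) (\<eta> x)) =
          (if restrict \<zeta> A = \<eta> then \<Prod>x\<in>A. flip_prob t (\<omega> x) (\<eta> x) else 0)"
        by (simp add: indicator_def)
    qed
    ultimately show ?thesis by simp
  qed
  have "cylinder A \<zeta> \<in> sets (time_evolved \<mu> t)"
    using sets_cylinder[OF A] sets_time_evolved[OF q t \<mu>] by simp
  then have "measure (time_evolved \<mu> t) (cylinder A \<zeta>) = (\<integral>\<sigma>. indicator (cylinder A \<zeta>) \<sigma> \<partial>time_evolved \<mu> t)"
    by simp
  also have "\<dots> = (\<integral>\<omega>. (\<Sum>\<eta>\<in>A \<rightarrow>\<^sub>E UNIV. indicator (cylinder A \<zeta>) \<eta> * (\<Prod>x\<in>A. flip_prob t (\<omega> x) (\<eta> x))) \<partial>\<mu>)"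
    by (rule integral_time_evolved_local[OF q t \<mu> A]) (auto simp: indicator_def cylinder_def)
  finally show ?thesis by (simp only: sel)
qed

text \<open>Once \<phi> is determined by the spins on \<open>A\<close> and at \<open>x\<close>, only
  the spin at \<open>x\<close> remains free, and ratios of cylinder probabilities suffice.\<close>

lemma cond_expect_spins_one_site:
  fixes \<nu> :: "('v \<Rightarrow> 's::finite) measure" and \<phi> :: "('v \<Rightarrow> 's) \<Rightarrow> real"
  assumes \<nu>: "prob_space \<nu>" "sets \<nu> = sets config_space" and A: "finite A" "x \<notin> A"
    and loc: "\<And>\<omega> \<omega>'. (\<forall>y\<in>insert x A. \<omega> y = \<omega>' y) \<Longrightarrow> \<phi> \<omega> = \<phi> \<omega>'"
  shows "cond_expect_spins \<nu> \<phi> A \<zeta> =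
    (\<Sum>j\<in>UNIV. \<phi> (\<zeta>(x := j)) * measure \<nu> (cylinder (insert x A) (\<zeta>(x := j)))) / measure \<nu> (cylinder A \<zeta>)"
proof -
  interpret prob_space \<nu> by fact
  have [measurable]: "cylinder (insert x A) \<eta> \<in> sets \<nu>" for \<eta>
    using sets_cylinder[of "insert x A"] A \<nu>(2) by simp
  have "indicator (cylinder A \<zeta>) \<sigma> *\<^sub>R \<phi> \<sigma> =
      (\<Sum>j\<in>UNIV. \<phi> (\<zeta>(x := j)) * indicator (cylinder (insert x A) (\<zeta>(x := j))) \<sigma>)" for \<sigma>
  proof -
    have "indicator (cylinder (insert x A) (\<zeta>(x := j))) \<sigma> =
        (if \<sigma> x = j then indicator (cylinder A \<zeta>) \<sigma> else (0::real))" for j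
      using A(2) by (auto simp: cylinder_def indicator_def)
    then have "(\<Sum>j\<in>UNIV. \<phi> (\<zeta>(x := j)) * indicator (cylinder (insert x A) (\<zeta>(x := j))) \<sigma>) =
        (\<Sum>j\<in>UNIV. if \<sigma> x = j then \<phi> (\<zeta>(x := j)) * indicator (cylinder A \<zeta>) \<sigma> else 0)"
      by (intro sum.cong) auto
    also have "\<dots> = \<phi> (\<zeta>(x := \<sigma> x)) * indicator (cylinder A \<zeta>) \<sigma>" by simp
    also have "\<dots> = indicator (cylinder A \<zeta>) \<sigma> *\<^sub>R \<phi> \<sigma>"
    proof (cases "\<sigma> \<in> cylinder A \<zeta>")
      case True
      then have "\<phi> (\<zeta>(x := \<sigma> x)) = \<phi> \<sigma>" by (intro loc) (auto simp: cylinder_def)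
      then show ?thesis by simp
    qed simp
    finally show ?thesis by simp
  qed
  then have "set_lebesgue_integral \<nu> (cylinder A \<zeta>) \<phi> =
      (\<integral>\<sigma>. (\<Sum>j\<in>UNIV. \<phi> (\<zeta>(x := j)) * indicator (cylinder (insert x A) (\<zeta>(x := j))) \<sigma>) \<partial>\<nu>)"
    unfolding set_lebesgue_integral_def by (intro Bochner_Integration.integral_cong refl)
  also have "\<dots> = (\<Sum>j\<in>UNIV. \<phi> (\<zeta>(x := j)) * measure \<nu> (cylinder (insert x A) (\<zeta>(x := j))))"
    by (subst Bochner_Integration.integral_sum) (auto simp: emeasure_eq_measure)
  finally show ?thesis unfolding cond_expect_spins_def by simp
qed

text \<open>The likelihood of the observed spin at \<open>y\<close> as a function of the initial
  spin \<open>k\<close>. At an unobserved site the likelihoods of all final spins add up to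
  1.\<close>

definition flip_field :: "real \<Rightarrow> 'v set \<Rightarrow> ('v \<Rightarrow> 's::finite) \<Rightarrow> 'v \<Rightarrow> real^'s" where
  "flip_field t A \<zeta> y = (if y \<in> A then \<chi> k. flip_prob t k (\<zeta> y) else 1)"

text \<open>The scalar \<open>c\<close> is there because \<open>flip_field\<close> tends to 1/q at
  observed sites and equals 1 elsewhere; normalised messages do not see it.\<close>

definition nearly_constant :: "real \<Rightarrow> ('v \<Rightarrow> real^'s) \<Rightarrow> bool" where
  "nearly_constant \<gamma> g \<longleftrightarrow> (\<forall>y. \<exists>c>0. \<forall>k. 0 < g y $ k \<and> within_factor \<gamma> (c * g y $ k) 1)"

lemma flip_prob_pos:
  fixes i j :: "'s::finite"
  assumes "CARD('s) \<ge> 2" "0 < t"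
  shows "0 < flip_prob t i j"
proof -
  let ?q = "real CARD('s)" and ?e = "exp (- (real CARD('s) / (real CARD('s) - 1)) * t)"
  have q: "?q \<ge> 2" using assms by simp
  then have "- (?q / (?q - 1)) * t < 0" using assms by (simp add: mult_pos_pos)
  then have e: "0 < ?e" "?e < 1" by (auto simp del: minus_mult_left)
  have "0 < 1 / ?q * (1 - ?e)" using e q by simp
  also have "\<dots> \<le> flip_prob t i j"
    unfolding flip_prob_def using e by (simp add: algebra_simps)
  finally show ?thesis .
qed

lemma flip_prob_le_1:
  fixes i j :: "'s::finite"
  assumes "CARD('s) \<ge> 2" "0 \<le> t"
  shows "flip_prob t i j \<le> 1"
  using member_le_sum[of j UNIV "flip_prob t i"] flip_prob_nonneg[OF assms] by (simp add: sum_flip_prob)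

lemma flip_prob_eventually_uniform:
  assumes q: "CARD('s::finite) \<ge> 2" and \<gamma>: "1 < \<gamma>"
  shows "\<exists>T>0. \<forall>t\<ge>T. \<forall>i j::'s. within_factor \<gamma> (real CARD('s) * flip_prob t i j) 1"
proof -
  let ?q = "real CARD('s)"
  have q': "0 < ?q / (?q - 1)" "0 < ?q" using q by auto
  have "((\<lambda>t. exp (- (?q / (?q - 1)) * t)) \<longlongrightarrow> 0) at_top"
    using q'(1) by (intro filterlim_compose[OF exp_at_bot]
      filterlim_tendsto_neg_mult_at_bot[OF tendsto_const]) (auto intro: filterlim_ident)
  then have "((\<lambda>t. ?q * flip_prob t i j) \<longlongrightarrow> ?q * (1 / ?q + ((if i = j then 1 else 0) - 1 / ?q) * 0)) at_top"
    for i j :: 's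
    unfolding flip_prob_def by (intro tendsto_intros)
  then have lim: "((\<lambda>t. ?q * flip_prob t i j) \<longlongrightarrow> 1) at_top" for i j :: 's using q' by simp
  have "\<forall>\<^sub>F t in at_top. within_factor \<gamma> (?q * flip_prob t i j) 1" for i j :: 's
  proof -
    have "\<forall>\<^sub>F t in at_top. ?q * flip_prob t i j < \<gamma>" using \<gamma> by (intro order_tendstoD(2)[OF lim])
    moreover have "\<forall>\<^sub>F t in at_top. 1 / \<gamma> < ?q * flip_prob t i j"
      using \<gamma> by (intro order_tendstoD(1)[OF lim]) simp
    ultimately show ?thesis
      by eventually_elim (use \<gamma> in \<open>auto simp: within_factor_def field_simps\<close>)
  qed
  then have "\<forall>\<^sub>F t in at_top. \<forall>i j::'s. within_factor \<gamma> (?q * flip_prob t i j) 1"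
    by (intro eventually_all_finite)
  then obtain T where "\<forall>t\<ge>T. \<forall>i j::'s. within_factor \<gamma> (?q * flip_prob t i j) 1"
    by (auto simp: eventually_at_top_linorder)
  \<comment> \<open>The maximum with 1 makes the time positive; at time 0 some flip probabilities
    vanish.\<close>
  then show ?thesis by (intro exI[of _ "max 1 T"]) auto
qed

lemma exhausting_eventually_subset:
  assumes "exhausting \<Lambda>" "finite D"
  shows "\<forall>\<^sub>F n in sequentially. D \<subseteq> \<Lambda> n"
proof -
  have "\<forall>\<^sub>F n in sequentially. y \<in> \<Lambda> n" for y
  proof -
    obtain m where "y \<in> \<Lambda> m" using assms(1) unfolding exhausting_def by blast
    then have "\<forall>n\<ge>m. y \<in> \<Lambda> n" using assms(1) unfolding exhausting_def incseq_def by blast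
    then show ?thesis by (auto simp: eventually_sequentially)
  qed
  then have "\<forall>\<^sub>F n in sequentially. \<forall>y\<in>D. y \<in> \<Lambda> n"
    using assms(2) by (simp add: eventually_ball_finite_distrib)
  then show ?thesis by eventually_elim auto
qed

section \<open>Cylinder probabilities in terms of messages\<close>

context rooted_cayley_tree
begin

lemma volume_weight_tree_ball:
  fixes Q :: "real^'s^'s"
  assumes "transpose Q = Q"
  shows "volume_weight E Q l (tree_ball n) \<omega> =
    (\<Prod>y\<in>tree_ball (Suc n) - {root}. Q $ \<omega> (parent y) $ \<omega> y) * (\<Prod>z\<in>sphere (Suc n). l $ \<omega> z)"
proof -
  have sym: "Q $ i $ j = Q $ j $ i" for i j
    using assms by (metis transpose_def vec_lambda_beta)
  have "(\<Prod>e\<in>{e \<in> E. e \<inter> tree_ball n \<noteq> {}}. edge_weight Q \<omega> e) =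
      (\<Prod>y\<in>tree_ball (Suc n) - {root}. edge_weight Q \<omega> {y, parent y})"
    unfolding edges_meeting_tree_ball
    by (subst prod.reindex) (auto intro: inj_on_subset[OF inj_on_parent_edge])
  also have "\<dots> = (\<Prod>y\<in>tree_ball (Suc n) - {root}. Q $ \<omega> (parent y) $ \<omega> y)"
    unfolding edge_weight_pair[OF assms] by (intro prod.cong refl sym)
  finally show ?thesis unfolding volume_weight_def outer_boundary_tree_ball by simp
qed

lemma volume_partition_tree_ball_pos:
  fixes Q :: "real^'s^'s"
  assumes Q: "transpose Q = Q" "\<And>i j. 0 < Q $ i $ j" and l: "\<And>i. 0 < l $ i"
  shows "0 < volume_partition E Q l (tree_ball n)"
  unfolding volume_partition_def outer_boundary_tree_ball tree_ball_Suc_eq[symmetric] volume_weight_tree_ball[OF Q(1)]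
proof (rule sum_pos)
  show "finite (tree_ball (Suc n) \<rightarrow>\<^sub>E (UNIV :: 's set))" by (intro finite_PiE finite_tree_ball) auto
  show "tree_ball (Suc n) \<rightarrow>\<^sub>E (UNIV :: 's set) \<noteq> {}" by (simp add: PiE_eq_empty_iff)
qed (auto intro!: mult_pos_pos prod_pos Q l)

text \<open>For the volume \<open>tree_ball n\<close> the chain gives the law on
  \<open>tree_ball (Suc n)\<close>, with \<open>l\<close> on the outermost sphere. Since
  \<open>A\<close> stays inside \<open>tree_ball n\<close>, that sphere carries no field; hence the
  height \<open>Suc n\<close>.\<close>

lemma measure_time_evolved_cylinder_eq_upward_weight:
  fixes Q :: "real^'s^'s" and \<mu> :: "('v \<Rightarrow> 's) measure"
  assumes q: "CARD('s) \<ge> 2" and t: "0 \<le> t" and Q: "transpose Q = Q"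
    and \<mu>: "tree_markov_chain E Q l \<mu>" and A: "A \<subseteq> tree_ball n"
  shows "measure (time_evolved \<mu> t) (cylinder A \<zeta>) =
    (\<Sum>k\<in>UNIV. upward_weight Q l (flip_field t A \<zeta>) (Suc n) root $ k) / volume_partition E Q l (tree_ball n)"
proof -
  let ?Z = "volume_partition E Q l (tree_ball n)" and ?B = "tree_ball (Suc n)"
  let ?g = "flip_field t A \<zeta> :: 'v \<Rightarrow> real^'s"
  have finA: "finite A" using A finite_tree_ball finite_subset by blast
  have AB: "A \<subseteq> ?B" using A by auto
  have ps: "prob_space \<mu>" "sets \<mu> = sets config_space"
    using \<mu> by (auto simp: tree_markov_chain_def)
  have "tree_ball n \<noteq> {}" using depth_eq_0_iff[of root] mem_tree_ball_iff[of root n] by auto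
  then have cyl: "measure \<mu> (cylinder ?B \<omega>) = volume_weight E Q l (tree_ball n) \<omega> / ?Z" for \<omega>
    using \<mu> finite_tree_ball connected_tree_ball
    unfolding tree_markov_chain_def tree_ball_Suc_eq outer_boundary_tree_ball[symmetric] by blast
  have weights: "(\<Prod>y\<in>?B. (if depth y = Suc n then l else ?g y) $ \<omega> y) =
      (\<Prod>x\<in>A. flip_prob t (\<omega> x) (\<zeta> x)) * (\<Prod>z\<in>sphere (Suc n). l $ \<omega> z)" for \<omega>
  proof -
    have "(\<Prod>y\<in>?B. (if depth y = Suc n then l else ?g y) $ \<omega> y) =
        (\<Prod>y\<in>tree_ball n. (if depth y = Suc n then l else ?g y) $ \<omega> y) *
        (\<Prod>y\<in>sphere (Suc n). (if depth y = Suc n then l else ?g y) $ \<omega> y)"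
      unfolding tree_ball_Suc_eq
      by (rule prod.union_disjoint) (auto simp: finite_tree_ball finite_sphere tree_ball_Int_sphere)
    also have "(\<Prod>y\<in>sphere (Suc n). (if depth y = Suc n then l else ?g y) $ \<omega> y) = (\<Prod>z\<in>sphere (Suc n). l $ \<omega> z)"
      by (intro prod.cong) (auto simp: sphere_def)
    also have "(\<Prod>y\<in>tree_ball n. (if depth y = Suc n then l else ?g y) $ \<omega> y) = (\<Prod>y\<in>tree_ball n. ?g y $ \<omega> y)"
      by (intro prod.cong) (auto simp: mem_tree_ball_iff)
    also have "\<dots> = (\<Prod>y\<in>A. ?g y $ \<omega> y)"
      using A by (intro prod.mono_neutral_right) (auto simp: finite_tree_ball flip_field_def)
    also have "\<dots> = (\<Prod>x\<in>A. flip_prob t (\<omega> x) (\<zeta> x))"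
      by (intro prod.cong) (auto simp: flip_field_def)
    finally show ?thesis .
  qed
  have "measure (time_evolved \<mu> t) (cylinder A \<zeta>) =
      (\<Sum>\<omega>\<in>?B \<rightarrow>\<^sub>E UNIV. (\<Prod>x\<in>A. flip_prob t (\<omega> x) (\<zeta> x)) * measure \<mu> (cylinder ?B \<omega>))"
    unfolding measure_time_evolved_cylinder[OF q t ps finA]
    using AB by (intro integral_local_eq_sum_cylinder ps finite_tree_ball prod.cong refl) (metis subsetD)
  also have "\<dots> = tree_sum Q (Suc n) (\<lambda>y. if depth y = Suc n then l else ?g y) / ?Z"
    unfolding tree_sum_def weights cyl volume_weight_tree_ball[OF Q] sum_divide_distrib
    by (intro sum.cong refl) (simp add: mult_ac)
  finally show ?thesis unfolding tree_sum_eq_upward_weight .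
qed

text \<open>Observing spin \<open>j\<close> at the root multiplies its weight by
  \<open>flip_prob t k j\<close>, where \<open>k\<close> is the initial spin. The partition function
  cancels in the quotient, and the denominator normalises the message.\<close>

lemma cond_expect_root_eq_message:
  fixes Q :: "real^'s^'s" and \<mu> :: "('v \<Rightarrow> 's) measure" and \<phi> :: "('v \<Rightarrow> 's) \<Rightarrow> real"
  assumes q: "CARD('s) \<ge> 2" and t: "0 < t" and Q: "transpose Q = Q" "\<And>i j. 0 < Q $ i $ j"
    and l: "\<And>i. 0 < l $ i" and \<mu>: "tree_markov_chain E Q l \<mu>"
    and A: "A \<subseteq> tree_ball n" "root \<notin> A"
    and loc: "\<And>\<omega> \<omega>'. (\<forall>y\<in>insert root A. \<omega> y = \<omega>' y) \<Longrightarrow> \<phi> \<omega> = \<phi> \<omega>'"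
  shows "cond_expect_spins (time_evolved \<mu> t) \<phi> A \<zeta> =
    (\<Sum>j\<in>UNIV. \<phi> (\<zeta>(root := j)) * (\<Sum>k\<in>UNIV. flip_prob t k j *
      message Q 1 (children root) (\<lambda>z. normalized (upward_weight Q l (flip_field t A \<zeta>) n z)) $ k))"
proof -
  let ?Z = "volume_partition E Q l (tree_ball n)" and ?g = "flip_field t A \<zeta> :: 'v \<Rightarrow> real^'s"
  let ?W = "message_weight Q 1 (children root) (upward_weight Q l ?g n)"
  have t0: "0 \<le> t" using t by simp
  have finA: "finite A" using A finite_tree_ball finite_subset by blast
  have ps: "prob_space \<mu>" "sets \<mu> = sets config_space"
    using \<mu> by (auto simp: tree_markov_chain_def)
  have Z: "0 < ?Z" by (rule volume_partition_tree_ball_pos[OF Q l])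
  have gpos: "0 < ?g y $ i" for y i
    using flip_prob_pos[OF q t] by (simp add: flip_field_def)
  have up: "0 < upward_weight Q l ?g n y $ i" for y i
    by (rule upward_weight_pos[OF Q(2) l gpos])
  have Wpos: "0 < ?W $ k" for k
    using up by (intro message_weight_pos) (auto intro: matrix_vector_pos Q(2))
  then have sW: "0 < (\<Sum>k\<in>UNIV. ?W $ k)" by (intro sum_pos) auto
  have denom: "measure (time_evolved \<mu> t) (cylinder A \<zeta>) = (\<Sum>k\<in>UNIV. ?W $ k) / ?Z"
    using A(2) unfolding measure_time_evolved_cylinder_eq_upward_weight[OF q t0 Q(1) \<mu> A(1)]
    by (simp add: flip_field_def)
  have "root \<in> tree_ball n" using depth_eq_0_iff[of root] mem_tree_ball_iff[of root n] by auto
  then have A': "insert root A \<subseteq> tree_ball n" using A by auto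
  have num: "measure (time_evolved \<mu> t) (cylinder (insert root A) (\<zeta>(root := j))) =
      (\<Sum>k\<in>UNIV. flip_prob t k j * ?W $ k) / ?Z" for j
  proof -
    have "upward_weight Q l (flip_field t (insert root A) (\<zeta>(root := j))) n z = upward_weight Q l ?g n z"
      if "z \<in> children root" for z
      using that by (intro upward_weight_cong) (auto simp: flip_field_def mem_children_iff)
    then have "(\<Prod>z\<in>children root. (Q *v upward_weight Q l (flip_field t (insert root A) (\<zeta>(root := j))) n z) $ k) =
        (\<Prod>z\<in>children root. (Q *v upward_weight Q l ?g n z) $ k)" for k
      by (intro prod.cong refl) simp
    then show ?thesis
      unfolding measure_time_evolved_cylinder_eq_upward_weight[OF q t0 Q(1) \<mu> A']
      by (simp add: message_weight_def flip_field_def)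
  qed
  have msg: "message Q 1 (children root) (\<lambda>z. normalized (upward_weight Q l ?g n z)) $ k =
      ?W $ k / (\<Sum>k\<in>UNIV. ?W $ k)" for k
    using message_normalized[of "children root" "upward_weight Q l ?g n" Q 1] up
    by (simp add: message_def normalized_def)
  have eq: "cond_expect_spins (time_evolved \<mu> t) \<phi> A \<zeta> =
      (\<Sum>j\<in>UNIV. \<phi> (\<zeta>(root := j)) * measure (time_evolved \<mu> t) (cylinder (insert root A) (\<zeta>(root := j)))) /
      measure (time_evolved \<mu> t) (cylinder A \<zeta>)"
    by (rule cond_expect_spins_one_site[OF prob_space_time_evolved[OF q t0 ps]
        sets_time_evolved[OF q t0 ps] finA A(2)]) (rule loc)
  show ?thesis
    unfolding eq num denom msg using Z sW by (simp add: sum_divide_distrib sum_distrib_left)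
qed

section \<open>Decay of the influence of distant spins\<close>

context
  fixes Q :: "real^'s^'s" and l :: "real^'s" and N :: "real^'s \<Rightarrow> real" and \<kappa> \<rho> \<gamma> :: real
  assumes Q: "\<And>i j. 0 < Q $ i $ j" and l: "l \<in> prob_simplex" "\<And>i. 0 < l $ i"
    and N: "\<And>x y. N (x + y) \<le> N x + N y" "\<And>x. N (- x) = N x" "\<And>x. norm x \<le> N x" "N 0 = 0"
    and \<kappa>\<rho>: "0 \<le> \<kappa>" "0 < \<rho>"
    and contracts: "\<forall>C::'v set. finite C \<and> card C = d \<longrightarrow> contracts_near Q l N \<kappa> \<rho> \<gamma> C"
begin

lemma contraction:
  fixes C :: "'v set"
  assumes "finite C" "card C = d" "\<And>k. 0 < g $ k \<and> within_factor \<gamma> (g $ k) 1"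
    "\<And>c. c \<in> C \<Longrightarrow> N (m c - l) \<le> \<rho>" "\<And>c. c \<in> C \<Longrightarrow> N (m' c - l) \<le> \<rho>"
    "\<And>c. c \<in> C \<Longrightarrow> N (m c - m' c) \<le> B" "0 \<le> B"
  shows "N (message Q g C m - message Q g C m') \<le> \<kappa> * B"
  using contracts[rule_format, OF conjI, OF assms(1,2), unfolded contracts_near_def,
    THEN spec, of g, THEN spec, of m, THEN spec, of m', THEN spec, of B] assms by simp

lemma invariance:
  fixes C :: "'v set"
  assumes "finite C" "card C = d" "\<And>k. 0 < g $ k \<and> within_factor \<gamma> (g $ k) 1"
    "\<And>c. c \<in> C \<Longrightarrow> N (m c - l) \<le> \<rho>"
  shows "N (message Q g C m - l) \<le> \<rho>"
  using contracts[rule_format, OF conjI, OF assms(1,2), unfolded contracts_near_def,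
    THEN spec, of g, THEN spec, of m, THEN spec, of m, THEN spec, of 0] assms by simp

lemma normalized_boundary_law: "normalized l = l"
  using l by (simp add: normalized_def prob_simplex_def)

text \<open>Height 0 is \<open>l\<close> itself, and invariance propagates upwards. The root is
  excluded since it has d + 1 children while \<open>contracts\<close> concerns sets of size
  \<open>d\<close>.\<close>

lemma normalized_upward_weight_near:
  assumes g: "nearly_constant \<gamma> g" and y: "y \<noteq> root"
  shows "N (normalized (upward_weight Q l g h y) - l) \<le> \<rho>"
  using y
proof (induction h arbitrary: y)
  case 0
  then show ?case using N \<kappa>\<rho> by (simp add: normalized_boundary_law)
next
  case (Suc h)
  have pos: "0 < g y $ k" for y k using g unfolding nearly_constant_def by blast
  obtain c where c: "c > 0" "\<And>k. within_factor \<gamma> (c * g y $ k) 1"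
    using g unfolding nearly_constant_def by blast
  have "N (message Q (c *\<^sub>R g y) (children y) (\<lambda>z. normalized (upward_weight Q l g h z)) - l) \<le> \<rho>"
    using c pos Suc.prems by (intro invariance Suc.IH)
      (auto simp: finite_children card_children mem_children_iff)
  then show ?case
    using c by (simp add: normalized_upward_weight_Suc[OF Q l(2) pos] message_scale_field del: upward_weight.simps)
qed

text \<open>Each level on which the fields agree contributes a factor \<kappa>, starting from the
  diameter bound 2 \<rho> of the invariant ball. A child is one level deeper and has
  \<open>j\<close> smaller by one; the bound \<open>Suc r\<close> ensures agreement at
  \<open>y\<close> whenever \<open>j\<close> is positive.\<close>

lemma normalized_upward_weight_decay:
  assumes g: "nearly_constant \<gamma> g" "nearly_constant \<gamma> g'" and agree: "\<And>y. depth y \<le> r \<Longrightarrow> g y = g' y"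
    and y: "y \<noteq> root" "depth y + j \<le> Suc r"
  shows "N (normalized (upward_weight Q l g h y) - normalized (upward_weight Q l g' h y)) \<le> \<kappa> ^ j * (2 * \<rho>)"
  using y
proof (induction j arbitrary: h y)
  case 0
  let ?m = "normalized (upward_weight Q l g h y)" and ?m' = "normalized (upward_weight Q l g' h y)"
  have "N (?m - ?m') \<le> N (?m - l) + N (- (?m' - l))"
    using N(1)[of "?m - l" "- (?m' - l)"] by simp
  also have "\<dots> \<le> \<rho> + \<rho>"
    unfolding N(2) using g 0 by (intro add_mono normalized_upward_weight_near)
  finally show ?case by simp
next
  case (Suc j)
  show ?case
  proof (cases h)
    case 0
    then show ?thesis using N \<kappa>\<rho> by simp
  next
    case (Suc h')
    have pos: "0 < g y $ k" "0 < g' y $ k" for y k using g unfolding nearly_constant_def by blast+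
    obtain c where c: "c > 0" "\<And>k. within_factor \<gamma> (c * g y $ k) 1"
      using g unfolding nearly_constant_def by blast
    have eq: "g' y = g y" using agree[of y] Suc.prems by simp
    have "N (message Q (c *\<^sub>R g y) (children y) (\<lambda>z. normalized (upward_weight Q l g h' z)) -
        message Q (c *\<^sub>R g y) (children y) (\<lambda>z. normalized (upward_weight Q l g' h' z)))
      \<le> \<kappa> * (\<kappa> ^ j * (2 * \<rho>))"
      using c pos Suc.prems \<kappa>\<rho> g by (intro contraction Suc.IH normalized_upward_weight_near)
        (auto simp: finite_children card_children depth_children children_neq_root)
    then show ?thesis
      using c unfolding Suc normalized_upward_weight_Suc[OF Q l(2) pos(1)]
        normalized_upward_weight_Suc[OF Q l(2) pos(2)]
      by (simp add: message_scale_field eq mult.assoc del: upward_weight.simps)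
  qed
qed

text \<open>The \<open>d + 1\<close> messages arriving at the root enter only through a continuous function, which
  need not contract.\<close>

lemma root_message_decay:
  assumes "\<kappa> < 1"
  shows "\<exists>\<delta>. \<delta> \<longlonglongrightarrow> 0 \<and> (\<forall>r g g' h. nearly_constant \<gamma> g \<longrightarrow> nearly_constant \<gamma> g' \<longrightarrow>
    (\<forall>y. depth y \<le> r \<longrightarrow> g y = g' y) \<longrightarrow>
    (\<Sum>k\<in>UNIV. \<bar>message Q 1 (children root) (\<lambda>z. normalized (upward_weight Q l g h z)) $ k -
      message Q 1 (children root) (\<lambda>z. normalized (upward_weight Q l g' h z)) $ k\<bar>) \<le> \<delta> r)"
proof -
  obtain K where K: "0 < K" "\<And>x. norm (Q *v x) \<le> norm x * K"
    using bounded_linear.pos_bounded[OF matrix_vector_mul_bounded_linear[of Q]] by blast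
  \<comment> \<open>The smallest entry of \<open>Q\<close> bounds \<open>Q *v m\<close> from below
    for every probability vector m, which turns the additive distance of messages into a relative
    one.\<close>
  define b where "b = Min (range (\<lambda>(i, j). Q $ i $ j))"
  have b: "0 < b" "\<And>i j. b \<le> Q $ i $ j"
    unfolding b_def using Q by (auto intro!: Min_le simp: Min_gr_iff)
  define e where "e r = \<kappa> ^ r * (2 * \<rho>) * K / b" for r
  have e0: "0 \<le> e r" for r using \<kappa>\<rho> K b by (simp add: e_def)
  \<comment> \<open>The relative error supplied by \<open>message_within_factor\<close>. The entries
    of a message add up to 1, so it also bounds the summed absolute error, uniformly in the fields
    and the height.\<close>
  define \<delta> where "\<delta> r = ((1 + e r) ^ card (children root))\<^sup>2 - 1" for r
  have "e \<longlonglongrightarrow> 0 * (2 * \<rho>) * K / b"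
    unfolding e_def using \<kappa>\<rho> assms by (intro tendsto_intros LIMSEQ_power_zero) (use b in auto)
  then have "\<delta> \<longlonglongrightarrow> ((1 + 0) ^ card (children root))\<^sup>2 - 1"
    unfolding \<delta>_def by (intro tendsto_intros) simp
  then have lim: "\<delta> \<longlonglongrightarrow> 0" by simp
  have "(\<Sum>k\<in>UNIV. \<bar>message Q 1 (children root) (\<lambda>z. normalized (upward_weight Q l g h z)) $ k -
      message Q 1 (children root) (\<lambda>z. normalized (upward_weight Q l g' h z)) $ k\<bar>) \<le> \<delta> r"
    if g: "nearly_constant \<gamma> g" "nearly_constant \<gamma> g'" and agree: "\<forall>y. depth y \<le> r \<longrightarrow> g y = g' y" for r g g' h
  proof -
    define m where "m z = normalized (upward_weight Q l g h z)" for z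
    define m' where "m' z = normalized (upward_weight Q l g' h z)" for z
    have lower: "b \<le> (Q *v normalized (upward_weight Q l u h z)) $ k" if u: "nearly_constant \<gamma> u" for u z k
    proof -
      have "0 < u y $ k" for y k using u unfolding nearly_constant_def by blast
      then have up: "0 < upward_weight Q l u h z $ i" for i by (rule upward_weight_pos[OF Q l(2)])
      let ?v = "normalized (upward_weight Q l u h z)"
      have s: "0 < (\<Sum>i\<in>UNIV. upward_weight Q l u h z $ i)" using up by (intro sum_pos) auto
      then have "(\<Sum>i\<in>UNIV. ?v $ i) = 1"
        by (simp add: normalized_def sum_divide_distrib[symmetric])
      then have "b = (\<Sum>i\<in>UNIV. b * ?v $ i)" by (simp add: sum_distrib_left[symmetric])
      also have "\<dots> \<le> (\<Sum>i\<in>UNIV. Q $ k $ i * ?v $ i)"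
        using b up s by (intro sum_mono mult_right_mono) (auto simp: normalized_def less_imp_le)
      finally show ?thesis by (simp add: matrix_vector_mult_def)
    qed
    have lm: "b \<le> (Q *v m z) $ k" "b \<le> (Q *v m' z) $ k" for z k
      using lower[OF g(1)] lower[OF g(2)] by (simp_all add: m_def m'_def)
    have close: "within_factor (1 + e r) ((Q *v m z) $ k) ((Q *v m' z) $ k)" if z: "z \<in> children root" for z k
    proof -
      have "depth root = 0" by (simp add: depth_eq_0_iff)
      then have "N (m z - m' z) \<le> \<kappa> ^ r * (2 * \<rho>)"
        unfolding m_def m'_def using z agree
        by (intro normalized_upward_weight_decay[OF g]) (auto simp: depth_children children_neq_root)
      then have "norm (m z - m' z) \<le> \<kappa> ^ r * (2 * \<rho>)" using N(3) order_trans by blast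
      then have "norm (m z - m' z) * K \<le> \<kappa> ^ r * (2 * \<rho>) * K" using K by (intro mult_right_mono) auto
      then have "norm (Q *v (m z - m' z)) \<le> e r * b" using K(2)[of "m z - m' z"] b by (simp add: e_def)
      then have "\<bar>(Q *v m z) $ k - (Q *v m' z) $ k\<bar> \<le> e r * b"
        using component_le_norm_cart[of "Q *v (m z - m' z)" k] by (simp add: matrix_vector_mult_diff_distrib)
      moreover have "e r * b \<le> e r * (Q *v m z) $ k" "e r * b \<le> e r * (Q *v m' z) $ k"
        using lm e0 by (auto intro: mult_left_mono)
      ultimately show ?thesis by (auto simp: within_factor_def algebra_simps abs_le_iff)
    qed
    have pos: "0 < (Q *v m z) $ k" "0 < (Q *v m' z) $ k" for z k
      using lm b(1) less_le_trans by blast+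
    have "within_factor ((1 * (1 + e r) ^ card (children root))\<^sup>2)
        (message Q 1 (children root) m $ k) (message Q 1 (children root) m' $ k)" for k
      using close pos e0 by (intro message_within_factor) (auto simp: within_factor_refl)
    then have "\<bar>message Q 1 (children root) m $ k - message Q 1 (children root) m' $ k\<bar>
        \<le> \<delta> r * message Q 1 (children root) m' $ k" for k
      unfolding \<delta>_def using e0[of r] pos
      by (intro within_factor_abs_diff) (auto intro!: message_pos less_imp_le one_le_power)
    then have "(\<Sum>k\<in>UNIV. \<bar>message Q 1 (children root) m $ k - message Q 1 (children root) m' $ k\<bar>)
        \<le> (\<Sum>k\<in>UNIV. \<delta> r * message Q 1 (children root) m' $ k)" by (intro sum_mono)
    also have "\<dots> = \<delta> r" unfolding sum_distrib_left[symmetric] using pos by (subst sum_message) auto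
    finally show ?thesis by (simp add: m_def[abs_def] m'_def[abs_def])
  qed
  then show ?thesis using lim by blast
qed

end

end

lemma nearly_constant_flip_field:
  fixes \<zeta> :: "'v \<Rightarrow> 's::finite"
  assumes q: "CARD('s) \<ge> 2" and t: "0 < t" and \<gamma>: "1 \<le> \<gamma>"
    and uni: "\<And>i j::'s. within_factor \<gamma> (real CARD('s) * flip_prob t i j) 1"
  shows "nearly_constant \<gamma> (flip_field t A \<zeta> :: 'v \<Rightarrow> real^'s)"
  unfolding nearly_constant_def
proof
  fix y
  show "\<exists>c>0. \<forall>k. 0 < (flip_field t A \<zeta> y :: real^'s) $ k \<and> within_factor \<gamma> (c * flip_field t A \<zeta> y $ k) 1"
  proof (cases "y \<in> A")
    case True
    then show ?thesis
      using q uni flip_prob_pos[OF q t] by (intro exI[of _ "real CARD('s)"]) (auto simp: flip_field_def)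
  next
    case False
    then show ?thesis using \<gamma> by (intro exI[of _ 1]) (auto simp: flip_field_def within_factor_refl)
  qed
qed

section \<open>Quasilocality for large times\<close>

theorem theorem1:
  fixes E :: "'v set set" and d :: nat
    and Q :: "real^'s^'s" and l :: "real^'s"
    and \<mu> :: "('v \<Rightarrow> 's) measure"
  assumes "CARD('s) \<ge> 2"
    and "cayley_tree d E"
    and "\<And>i j. 0 < Q $ i $ j"
    and "transpose Q = Q"
    and "boundary_law d Q l"
    and "boundary_law_stable d Q l"
    and "tree_markov_chain E Q l \<mu>"
  shows "\<exists>t\<^sub>R::real. 0 \<le> t\<^sub>R \<and> (\<forall>t\<ge>t\<^sub>R. quasilocally_gibbs (time_evolved \<mu> t))"
proof -
  have l: "l \<in> prob_simplex" "\<And>i. 0 < l $ i" using assms(5) by (auto simp: boundary_law_def)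
  obtain N :: "real^'s \<Rightarrow> real" and \<kappa> \<rho> \<gamma> where
    N: "\<And>x y. N (x + y) \<le> N x + N y" "\<And>x. N (- x) = N x" "\<And>x. norm x \<le> N x" "N 0 = 0"
    and \<kappa>: "0 \<le> \<kappa>" "\<kappa> < 1" and \<rho>: "0 < \<rho>" and \<gamma>: "1 < \<gamma>"
    and contracts: "\<forall>C::'v set. finite C \<and> card C = d \<longrightarrow> contracts_near Q l N \<kappa> \<rho> \<gamma> C"
    by (rule message_local_contraction[OF assms(3,5,6), where 'c = 'v]) (rule that)
  obtain T where T: "0 < T" "\<forall>t\<ge>T. \<forall>i j::'s. within_factor \<gamma> (real CARD('s) * flip_prob t i j) 1"
    using flip_prob_eventually_uniform[OF assms(1) \<gamma>] by blast
  have "good_config (time_evolved \<mu> t) \<eta>" if t: "T \<le> t" for t \<eta>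
    unfolding good_config_def
  proof (intro allI impI)
    fix x :: 'v and \<phi> :: "('v \<Rightarrow> 's) \<Rightarrow> real" and \<Lambda> :: "nat \<Rightarrow> 'v set"
    assume "local_function \<phi>" and \<Lambda>: "exhausting \<Lambda>"
    then obtain D where D: "finite D" "\<And>\<omega> \<omega>'. (\<forall>x\<in>D. \<omega> x = \<omega>' x) \<Longrightarrow> \<phi> \<omega> = \<phi> \<omega>'"
      unfolding local_function_def by blast
    interpret rooted_cayley_tree E d x by unfold_locales (rule assms(2))
    have t0: "0 < t" using T(1) t by simp
    let ?msg = "\<lambda>g h. message Q 1 (children x) (\<lambda>z. normalized (upward_weight Q l g h z))"
    have near: "nearly_constant \<gamma> (flip_field t A \<zeta> :: 'v \<Rightarrow> real^'s)" for A \<zeta>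
      using T(2) t \<gamma> by (intro nearly_constant_flip_field[OF assms(1) t0]) auto
    obtain \<delta> where \<delta>: "\<delta> \<longlonglongrightarrow> 0" and \<delta>_bound: "\<And>r g g' h. nearly_constant \<gamma> g \<Longrightarrow> nearly_constant \<gamma> g' \<Longrightarrow>
        (\<And>y. depth y \<le> r \<Longrightarrow> g y = g' y) \<Longrightarrow> (\<Sum>k\<in>UNIV. \<bar>?msg g h $ k - ?msg g' h $ k\<bar>) \<le> \<delta> r"
      using root_message_decay[of Q l N \<kappa> \<rho> \<gamma>, OF assms(3) l N \<kappa>(1) \<rho> contracts \<kappa>(2)] by blast
    \<comment> \<open>Once \<Lambda> n contains x and the support of \<phi>, only the values of
      \<phi> at \<eta> modified in \<open>x\<close> enter, whatever the outer spins are.\<close>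
    define M where "M = (\<Sum>j\<in>UNIV. \<bar>\<phi> (\<eta>(x := j))\<bar>)"
    have M: "0 \<le> M" by (simp add: M_def sum_nonneg)
    have bound: "\<bar>cond_expect_concat (time_evolved \<mu> t) \<phi> x (\<Lambda> n) \<eta> \<Delta> \<xi>1 -
        cond_expect_concat (time_evolved \<mu> t) \<phi> x (\<Lambda> n) \<eta> \<Delta> \<xi>2\<bar> \<le> M * \<delta> r"
      if n: "tree_ball r \<subseteq> \<Lambda> n" "insert x D \<subseteq> \<Lambda> n" and \<Delta>: "finite \<Delta>" "\<Lambda> n \<subseteq> \<Delta>" for n r \<Delta> \<xi>1 \<xi>2
    proof -
      define A where "A = (\<Lambda> n - {x}) \<union> (\<Delta> - \<Lambda> n)"
      define \<zeta> where "\<zeta> \<xi> = (\<lambda>y. if y \<in> \<Lambda> n then \<eta> y else \<xi> y)" for \<xi>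
      define p where "p \<xi> = (\<lambda>h. ?msg (flip_field t A (\<zeta> \<xi>)) h)" for \<xi>
      have "finite A" using \<Delta> by (auto simp: A_def intro: finite_subset)
      \<comment> \<open>The height grows with \<Delta>, over which the supremum is taken; the bound
        \<open>\<delta> r\<close> does not depend on it.\<close>
      then obtain h where h: "A \<subseteq> tree_ball h" using finite_subset_tree_ball by blast
      have xA: "x \<notin> A" using n by (auto simp: A_def)
      have DA: "D \<subseteq> insert x A" using n by (auto simp: A_def)
      have ce: "cond_expect_concat (time_evolved \<mu> t) \<phi> x (\<Lambda> n) \<eta> \<Delta> \<xi> =
          (\<Sum>j\<in>UNIV. \<phi> (\<eta>(x := j)) * (\<Sum>k\<in>UNIV. flip_prob t k j * p \<xi> h $ k))" for \<xi>
      proof -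
        have "\<phi> ((\<zeta> \<xi>)(x := j)) = \<phi> (\<eta>(x := j))" for j
          using n by (intro D(2)) (auto simp: \<zeta>_def)
        moreover have "cond_expect_spins (time_evolved \<mu> t) \<phi> A (\<zeta> \<xi>) =
            (\<Sum>j\<in>UNIV. \<phi> ((\<zeta> \<xi>)(x := j)) * (\<Sum>k\<in>UNIV. flip_prob t k j * p \<xi> h $ k))"
          unfolding p_def
          by (rule cond_expect_root_eq_message[OF assms(1) t0 assms(4,3) l(2) assms(7) h xA])
             (use D(2) DA in blast)
        ultimately show ?thesis by (simp add: cond_expect_concat_def A_def \<zeta>_def)
      qed
      have diff: "\<bar>\<Sum>k\<in>UNIV. flip_prob t k j * (p \<xi>1 h $ k - p \<xi>2 h $ k)\<bar> \<le> \<delta> r" for j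
      proof -
        have "\<bar>\<Sum>k\<in>UNIV. flip_prob t k j * (p \<xi>1 h $ k - p \<xi>2 h $ k)\<bar>
            \<le> (\<Sum>k\<in>UNIV. 1 * \<bar>p \<xi>1 h $ k - p \<xi>2 h $ k\<bar>)"
          using flip_prob_le_1[OF assms(1)] flip_prob_pos[OF assms(1) t0] t0
          by (intro order_trans[OF sum_abs] sum_mono)
            (auto simp: abs_mult less_imp_le intro!: mult_left_le_one_le)
        also have "\<dots> \<le> \<delta> r"
        proof -
          have "flip_field t A (\<zeta> \<xi>1) y = (flip_field t A (\<zeta> \<xi>2) y :: real^'s)" if "depth y \<le> r" for y
            using that n(1) by (auto simp: flip_field_def \<zeta>_def mem_tree_ball_iff[symmetric])
          then show ?thesis unfolding p_def mult_1 by (intro \<delta>_bound near)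
        qed
        finally show ?thesis .
      qed
      have "cond_expect_concat (time_evolved \<mu> t) \<phi> x (\<Lambda> n) \<eta> \<Delta> \<xi>1 -
          cond_expect_concat (time_evolved \<mu> t) \<phi> x (\<Lambda> n) \<eta> \<Delta> \<xi>2 =
          (\<Sum>j\<in>UNIV. \<phi> (\<eta>(x := j)) * (\<Sum>k\<in>UNIV. flip_prob t k j * (p \<xi>1 h $ k - p \<xi>2 h $ k)))"
        unfolding ce by (simp add: right_diff_distrib sum_subtractf)
      also have "\<bar>\<dots>\<bar> \<le> (\<Sum>j\<in>UNIV. \<bar>\<phi> (\<eta>(x := j))\<bar> * \<delta> r)"
        unfolding abs_mult
        by (intro order_trans[OF sum_abs] sum_mono order_trans[OF eq_refl[OF abs_mult]]
            mult_left_mono diff abs_ge_zero)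
      finally show ?thesis unfolding M_def sum_distrib_right .
    qed
    let ?S = "\<lambda>n. SUP (\<xi>\<^sub>1, \<xi>\<^sub>2, \<Delta>) \<in> UNIV \<times> UNIV \<times> {\<Delta>. finite \<Delta> \<and> \<Lambda> n \<subseteq> \<Delta>}.
       \<bar>cond_expect_concat (time_evolved \<mu> t) \<phi> x (\<Lambda> n) \<eta> \<Delta> \<xi>\<^sub>1 -
        cond_expect_concat (time_evolved \<mu> t) \<phi> x (\<Lambda> n) \<eta> \<Delta> \<xi>\<^sub>2\<bar>"
    show "?S \<longlonglongrightarrow> 0"
    proof (rule tendstoI)
      fix \<epsilon> :: real assume \<epsilon>: "0 < \<epsilon>"
      have "(\<lambda>r. M * \<delta> r) \<longlonglongrightarrow> M * 0" by (intro tendsto_intros \<delta>)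
      then have "\<forall>\<^sub>F r in sequentially. M * \<delta> r < \<epsilon>" using \<epsilon> by (intro order_tendstoD(2)) auto
      then obtain r where r: "M * \<delta> r < \<epsilon>" by (auto simp: eventually_sequentially)
      \<comment> \<open>The radius \<open>r\<close> is fixed before \<open>n\<close>, so any
        exhausting sequence eventually covers the ball on which the fields must agree.\<close>
      have "\<forall>\<^sub>F n in sequentially. tree_ball r \<union> insert x D \<subseteq> \<Lambda> n"
        using D(1) finite_tree_ball by (intro exhausting_eventually_subset[OF \<Lambda>]) auto
      then show "\<forall>\<^sub>F n in sequentially. dist (?S n) 0 < \<epsilon>"
      proof eventually_elim
        case (elim n)
        let ?I = "UNIV \<times> UNIV \<times> {\<Delta>. finite \<Delta> \<and> \<Lambda> n \<subseteq> \<Delta>} :: (('v \<Rightarrow> 's) \<times> ('v \<Rightarrow> 's) \<times> 'v set) set"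
        let ?f = "\<lambda>(\<xi>\<^sub>1, \<xi>\<^sub>2, \<Delta>). \<bar>cond_expect_concat (time_evolved \<mu> t) \<phi> x (\<Lambda> n) \<eta> \<Delta> \<xi>\<^sub>1 -
          cond_expect_concat (time_evolved \<mu> t) \<phi> x (\<Lambda> n) \<eta> \<Delta> \<xi>\<^sub>2\<bar>"
        have le: "?f i \<le> M * \<delta> r" if "i \<in> ?I" for i
          using that elim by (auto intro!: bound)
        have "finite (\<Lambda> n)" using \<Lambda> by (simp add: exhausting_def)
        \<comment> \<open>Equal outer configurations give the difference 0: the index set is
          nonempty and the supremum is nonnegative.\<close>
        then have i0: "(\<eta>, \<eta>, \<Lambda> n) \<in> ?I" by auto
        have "?S n \<le> M * \<delta> r" using i0 le by (intro cSUP_least) blast+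
        moreover have "?f (\<eta>, \<eta>, \<Lambda> n) \<le> ?S n"
          using i0 le by (intro cSUP_upper bdd_aboveI2[where M = "M * \<delta> r"])
        ultimately show ?case using r by simp
      qed
    qed
  qed
  then show ?thesis using T(1) by (intro exI[of _ T]) (auto simp: quasilocally_gibbs_def)
qed

end
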